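(* Let $n,k,r$ be integers such that either $k=1$ and $2\le r\le n-3$, or $k\ge 2$, $r\ge 2$ and $kr\le n-2$. If $T$ is a tree of order $n$ with $k$ pendent paths of length $r$ that has maximum Mostar index among all such trees, then $T\cong S^r_{n,k}$.
   Context: For a connected simple graph $G$, the Mostar index is $Mo(G)=\sum_{uv\in E(G)}|n_u-n_v|$, where for an edge $e=uv$, $n_u$ is the number of vertices of $G$ closer (in graph distance) to $u$ than to $v$, and $n_v$ is the number of vertices closer to $v$ than to $u$. The order of a graph is its number of vertices. A path $u_0u_1\cdots u_r$ with $r\ge1$ in a graph $G$ is called a pendent path of length $r$ at $u_r$ if $d_G(u_0)=1$, $d_G(u_r)\ge 2$ and, when $r\ge 2$, $d_G(u_i)=2$ for $1\le i\le r-1$. (Note that $u_r$ may have degree exactly $2$.) "With $k$ pendent paths of length $r$" means that the number of pendent paths of length $r$ is exactly $k$. For $k=1$ and $2\le r\le n-3$, or $k\ge2$, $r\ge2$ and $kr\le n-2$, $S^r_{n,k}$ is the $n$-vertex tree consisting of $k$ pendent paths of length $r$ and $n-kr-1$ pendent paths of length one, all attached at a common vertex. *)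

theory Defs
  imports
    "Graph_Theory.Digraph_Component"
    "Graph_Theory.Digraph_Isomorphism"
    "Graph_Theory.Pair_Digraph"
    "Graph_Theory.Shortest_Path"
    "Graph_Theory.Vertex_Walk"
begin

text \<open>
  A finite simple graph is a \<^locale>\<open>pair_graph\<close>: a finite, loop-free, symmetric
  digraph without parallel arcs. Each undirected edge \<open>uv\<close> is the pair of arcs \<open>(u,v)\<close>,
  \<open>(v,u)\<close>, so the degree of a vertex is its out-degree.
\<close>

definition order :: "'a pair_pre_digraph \<Rightarrow> nat" where
  "order G = card (pverts G)"

definition degree :: "'a pair_pre_digraph \<Rightarrow> 'a \<Rightarrow> nat" where
  "degree G v = out_degree (with_proj G) v"

definition edges :: "'a pair_pre_digraph \<Rightarrow> 'a set set" where
  "edges G = (\<lambda>(u, v). {u, v}) ` parcs G"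

definition dist_graph :: "'a pair_pre_digraph \<Rightarrow> 'a \<Rightarrow> 'a \<Rightarrow> ereal" where
  "dist_graph G u v = wf_digraph.\<mu> (with_proj G) (\<lambda>_. 1) u v"

text \<open>
  The library predicate \<^const>\<open>tree\<close> is not usable here: in a symmetric digraph it counts
  the closed walk \<open>u, v, u\<close> along an edge as a cycle. The cycles of the undirected graph are
  the cycles of length at least 3.
\<close>

definition is_tree :: "'a pair_pre_digraph \<Rightarrow> bool" where
  "is_tree G \<longleftrightarrow> pair_graph G \<and> connected (with_proj G) \<and>
     \<not> (\<exists>p. pre_digraph.cycle (with_proj G) p \<and> 3 \<le> length p)"

definition closer :: "'a pair_pre_digraph \<Rightarrow> 'a \<Rightarrow> 'a \<Rightarrow> nat" where
  "closer G u v = card {w \<in> pverts G. dist_graph G w u < dist_graph G w v}"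

definition edge_imbalance :: "'a pair_pre_digraph \<Rightarrow> 'a set \<Rightarrow> int" where
  "edge_imbalance G e =
     (THE d. \<exists>u v. e = {u, v} \<and> d = \<bar>int (closer G u v) - int (closer G v u)\<bar>)"

lemma edge_imbalance_doubleton:
  "edge_imbalance G {u, v} = \<bar>int (closer G u v) - int (closer G v u)\<bar>"
  unfolding edge_imbalance_def
  by (rule the_equality) (auto simp: doubleton_eq_iff)

definition mostar :: "'a pair_pre_digraph \<Rightarrow> int" where
  "mostar G = (\<Sum>e\<in>edges G. edge_imbalance G e)"

text \<open>
  A pendent path \<open>u\<^sub>0 u\<^sub>1 \<dots> u\<^sub>r\<close> is represented by its vertex list, starting at the leaf
  \<open>u\<^sub>0\<close>. As the two ends have degree 1 and degree at least 2, the list is determined by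
  the path, so counting lists counts paths.
\<close>

definition pendent_path :: "'a pair_pre_digraph \<Rightarrow> nat \<Rightarrow> 'a list \<Rightarrow> bool" where
  "pendent_path G r p \<longleftrightarrow> 1 \<le> r \<and> vpath p (with_proj G) \<and> vwalk_length p = r \<and>
     degree G (p ! 0) = 1 \<and> 2 \<le> degree G (p ! r) \<and>
     (\<forall>i. 1 \<le> i \<and> i \<le> r - 1 \<longrightarrow> degree G (p ! i) = 2)"

definition trees_with_pendent_paths :: "nat \<Rightarrow> nat \<Rightarrow> nat \<Rightarrow> 'a pair_pre_digraph set" where
  "trees_with_pendent_paths n k r =
     {T. is_tree T \<and> order T = n \<and> card {p. pendent_path T r p} = k}"

text \<open>
  A concrete copy of \<open>S\<^sup>r\<^bsub>n,k\<^esub>\<close> on the vertices \<open>0, \<dots>, n - 1\<close> with centre \<open>0\<close>. For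
  \<open>i < k\<close> the vertices \<open>i r + 1, \<dots>, i r + r\<close> form, in this order from the centre outwards,
  a path attached to \<open>0\<close>; the remaining vertices \<open>k r + 1, \<dots>, n - 1\<close> are leaves at \<open>0\<close>.
  \<open>S_parent\<close> is the neighbour of \<open>j > 0\<close> on the way to the centre.
\<close>

definition S_parent :: "nat \<Rightarrow> nat \<Rightarrow> nat \<Rightarrow> nat" where
  "S_parent k r j = (if j \<le> k * r \<and> \<not> r dvd (j - 1) then j - 1 else 0)"

definition S_tree :: "nat \<Rightarrow> nat \<Rightarrow> nat \<Rightarrow> nat pair_pre_digraph" where
  "S_tree n k r = \<lparr> pverts = {..<n},
     parcs = (\<Union>j\<in>{1..<n}. {(j, S_parent k r j), (S_parent k r j, j)}) \<rparr>"

end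

theory Submission
  imports Defs
begin

text \<open>
  Every edge of a tree of order \<open>n\<close> has imbalance at most \<open>n - 2\<close>, with equality exactly for
  the pendent edges, and the \<open>i\<close>-th edge of a pendent path has imbalance \<open>\<bar>n - 2 i\<bar>\<close> whatever
  the rest of the tree looks like. Distinct pendent paths of length \<open>r\<close> are disjoint up to their
  ends: otherwise they would cover the tree and \<open>n \<le> 2 r\<close>. So \<open>k r\<close> edges contribute a fixed
  amount, and the remaining \<open>n - 1 - k r\<close> edges contribute at most \<open>n - 2\<close> each. The tree
  \<open>S\<^sup>r\<^bsub>n,k\<^esub>\<close> attains this bound; hence in a maximal tree all remaining edges are pendent, which
  forces all pendent paths of length \<open>r\<close> and all further leaves to hang at one vertex.
\<close>

section \<open>Distances, cycles and edge counts\<close>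

text \<open>Equality in the bound n - 2 is read off by counting: the two numbers
  \<open>closer\<close> are each at least 1 and together at most n, so imbalance n - 2 forces one of
  them to be 1, and in the absence of triangles that end is a leaf. Maximality compares only trees
  on the vertex type \<open>'a\<close>, whereas \<open>S_tree\<close> lives on \<open>nat\<close>;
  the competitor is therefore a relabelled copy \<open>S_image\<close> on the vertices of the
  maximal tree itself. The path edges contribute the same to both trees and cancel. For k = 1 the
  length r may exceed n / 2, so the absolute values cannot be resolved, and 2 r < n is available
  only once two distinct paths exist. The condition r + 3 \<le> n for k = 1 gives the centre degree
  at least 3: with a single leaf at the centre the tree would be a path, which has two pendent paths
  of length r. The final isomorphism rests on a count as well: the maximal tree is shown to contain
  a relabelled S with n - 1 edges, and being free of cycles it has no room for another edge.\<close>

lemma (in pair_wf_digraph) awalk_length_iff: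
  assumes "u \<in> pverts G"
  shows "(\<exists>p. awalk u p v \<and> length p = n) \<longleftrightarrow> (u, v) \<in> parcs G ^^ n"
  using assms
proof (induction n arbitrary: u)
  case 0
  then show ?case by (auto simp: awalk_def)
next
  case (Suc n)
  show ?case
  proof
    assume "\<exists>p. awalk u p v \<and> length p = Suc n"
    then obtain e p where "awalk u (e # p) v" "length p = n" by (auto simp: length_Suc_conv)
    then have e: "e \<in> parcs G" "fst e = u" "awalk (snd e) p v"
      by (auto simp: awalk_Cons_iff)
    then have "(snd e, v) \<in> parcs G ^^ n"
      using Suc.IH[of "snd e"] \<open>length p = n\<close> arc_snd_in_verts by blast
    then show "(u, v) \<in> parcs G ^^ Suc n"
      using e by (metis prod.collapse relpow_Suc_I2)
  next
    assume "(u, v) \<in> parcs G ^^ Suc n"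
    then obtain w where w: "(u, w) \<in> parcs G" "(w, v) \<in> parcs G ^^ n" by (meson relpow_Suc_D2)
    then obtain p where "awalk w p v" "length p = n"
      using Suc.IH[of w] in_arcsD2 by blast
    then have "awalk u ((u, w) # p) v" "length ((u, w) # p) = Suc n"
      using w Suc.prems by (auto simp: awalk_Cons_iff)
    then show "\<exists>p. awalk u p v \<and> length p = Suc n" by blast
  qed
qed

text \<open>The infimum of walk costs in \<open>ereal\<close> is attained, since unit costs make it
  an infimum of walk lengths. From here on distances are exponents of the adjacency
  relation.\<close>

lemma (in pair_wf_digraph) dist_graph_eq_Least:
  assumes "u \<in> pverts G" "(u, v) \<in> (parcs G)\<^sup>*"
  shows "dist_graph G u v = ereal (real (LEAST n. (u, v) \<in> parcs G ^^ n))"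
proof -
  let ?L = "LEAST n. (u, v) \<in> parcs G ^^ n"
  have cost: "awalk_cost (\<lambda>_. 1) p = real (length p)" for p :: "('a \<times> 'a) list"
    by (induction p) auto
  have "(u, v) \<in> parcs G ^^ ?L"
    using assms(2) LeastI_ex[of "\<lambda>n. (u, v) \<in> parcs G ^^ n"] by (meson rtrancl_imp_relpow)
  then obtain p where p: "awalk u p v" "length p = ?L"
    using awalk_length_iff[OF assms(1)] by blast
  have least: "?L \<le> length q" if "awalk u q v" for q
    using that awalk_length_iff[OF assms(1), of v "length q"] by (intro Least_le) blast
  have "\<mu> (\<lambda>_. 1) u v = ereal ?L"
    unfolding \<mu>_def
  proof (rule antisym)
    show "(INF p\<in>{p. awalk u p v}. ereal (awalk_cost (\<lambda>_. 1) p)) \<le> ereal ?L"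
      using p by (intro INF_lower2[of p]) (auto simp: cost)
    show "ereal ?L \<le> (INF p\<in>{p. awalk u p v}. ereal (awalk_cost (\<lambda>_. 1) p))"
      using least by (intro INF_greatest) (auto simp: cost)
  qed
  then show ?thesis by (simp add: dist_graph_def)
qed

lemma (in pair_graph) connected_iff:
  "connected (with_proj G) \<longleftrightarrow>
     pverts G \<noteq> {} \<and> (\<forall>u\<in>pverts G. \<forall>v\<in>pverts G. (u, v) \<in> (parcs G)\<^sup>*)"
proof -
  have "mk_symmetric (with_proj G) = G"
    by (rule pair_pre_digraph.equality) (auto simp: mk_symmetric_def intro: arcs_symmetric)
  then have "connected (with_proj G) \<longleftrightarrow> strongly_connected (with_proj G)"
    by (simp add: connected_def)
  moreover have "u \<rightarrow>\<^sup>*\<^bsub>with_proj G\<^esub> v \<longleftrightarrow> (u, v) \<in> (parcs G)\<^sup>*" if "u \<in> pverts G" for u v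
  proof -
    have "(\<exists>p. awalk u p v) \<longleftrightarrow> (\<exists>n. (u, v) \<in> parcs G ^^ n)"
      using awalk_length_iff[OF that] by blast
    then show ?thesis
      by (simp add: reachable_awalk rtrancl_power)
  qed
  ultimately show ?thesis by (auto simp: strongly_connected_def)
qed

text \<open>Cyclic indexing treats all vertices alike and avoids the repeated end vertex of a closed
  walk.\<close>

definition polygon :: "('a \<times> 'a) set \<Rightarrow> 'a list \<Rightarrow> bool" where
  "polygon E vs \<longleftrightarrow> 3 \<le> length vs \<and> distinct vs \<and>
     (\<forall>i<length vs. (vs ! i, vs ! (Suc i mod length vs)) \<in> E)"

lemma pcas_iff_nth:
  assumes "p \<noteq> []"
  shows "pcas u p v \<longleftrightarrow> fst (p ! 0) = u \<and> snd (last p) = v \<and>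
    (\<forall>i. Suc i < length p \<longrightarrow> snd (p ! i) = fst (p ! Suc i))"
  using assms
proof (induction p arbitrary: u)
  case (Cons e p)
  show ?case
  proof (cases "p = []")
    case False
    then have "pcas u (e # p) v \<longleftrightarrow> fst e = u \<and> fst (p ! 0) = snd e \<and> snd (last p) = v \<and>
      (\<forall>i. Suc i < length p \<longrightarrow> snd (p ! i) = fst (p ! Suc i))"
      using Cons.IH by auto
    also have "\<dots> \<longleftrightarrow> fst e = u \<and> snd (last p) = v \<and>
        (\<forall>i<length p. snd ((e # p) ! i) = fst (p ! i))"
    proof -
      obtain m where "length p = Suc m" using False by (cases p) auto
      then show ?thesis unfolding \<open>length p = Suc m\<close> All_less_Suc2 by (simp add: eq_commute conj_ac cong: conj_cong)
    qed
    finally show ?thesis using False by simp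
  qed auto
qed simp

lemma tl_pawalk_verts: "pcas u p v \<Longrightarrow> tl (pawalk_verts u p) = map snd p"
proof (induction p arbitrary: u)
  case (Cons e p)
  then show ?case by (cases p) auto
qed simp

lemma (in pair_wf_digraph) cycle_iff_polygon:
  "(\<exists>p. cycle p \<and> 3 \<le> length p) \<longleftrightarrow> (\<exists>vs. polygon (parcs G) vs)"
proof
  assume "\<exists>p. cycle p \<and> 3 \<le> length p"
  then obtain p u where p: "awalk u p u" "distinct (tl (pawalk_verts u p))" "3 \<le> length p"
    unfolding cycle_def by auto
  define m where "m = length p"
  have ne: "p \<noteq> []" and c: "pcas u p u" and arcs: "set p \<subseteq> parcs G"
    using p by (auto simp: awalk_def)
  have nth: "fst (p ! 0) = u" "snd (last p) = u"
    "\<And>i. Suc i < m \<Longrightarrow> snd (p ! i) = fst (p ! Suc i)"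
    using c pcas_iff_nth[OF ne] m_def by auto
  \<comment> \<open>The heads of the arcs are the vertex list without its first entry, which is
    exactly the list that \<open>cycle\<close> requires to be distinct.\<close>
  have "(map snd p ! i, map snd p ! (Suc i mod m)) \<in> parcs G" if "i < m" for i
  proof -
    have "Suc i mod m < m" using that by simp
    moreover have "snd (p ! i) = fst (p ! (Suc i mod m))"
    proof (cases "Suc i = m")
      case True
      then have "last p = p ! i" using last_conv_nth[OF ne] by (simp add: m_def[symmetric] True[symmetric])
      then show ?thesis using nth True by simp
    qed (use nth that in simp)
    ultimately have "(snd (p ! i), snd (p ! (Suc i mod m))) = p ! (Suc i mod m)" by simp
    also have "\<dots> \<in> parcs G" using arcs \<open>Suc i mod m < m\<close> by (auto simp: m_def)
    finally show ?thesis using that \<open>Suc i mod m < m\<close> by (simp add: m_def)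
  qed
  then have "polygon (parcs G) (map snd p)"
    using p(2,3) by (simp add: polygon_def tl_pawalk_verts[OF c] m_def)
  then show "\<exists>vs. polygon (parcs G) vs" by blast
next
  assume "\<exists>vs. polygon (parcs G) vs"
  then obtain vs where vs: "polygon (parcs G) vs" by blast
  define m where "m = length vs"
  have m: "3 \<le> m" "distinct vs" "\<And>i. i < m \<Longrightarrow> (vs ! i, vs ! (Suc i mod m)) \<in> parcs G"
    using vs by (auto simp: polygon_def m_def)
  define p where "p = map (\<lambda>i. (vs ! i, vs ! (Suc i mod m))) [0..<m]"
  have len: "length p = m" and ne: "p \<noteq> []" using m by (auto simp: p_def)
  have c: "pcas (vs ! 0) p (vs ! 0)"
    unfolding pcas_iff_nth[OF ne] using m(1) by (auto simp: p_def last_map)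
  have snds: "map snd p = rotate1 vs"
    by (rule nth_equalityI) (auto simp: p_def m_def nth_rotate1)
  have "awalk (vs ! 0) p (vs ! 0)"
    using m c in_arcsD1[OF m(3)[of 0]] by (auto simp: awalk_def p_def)
  then have "cycle p"
    using ne m(2) snds tl_pawalk_verts[OF c] by (auto simp: cycle_def)
  then show "\<exists>p. cycle p \<and> 3 \<le> length p" using len m by blast
qed

text \<open>Longest path argument: every neighbour of the first vertex lies on the path, and a
  neighbour other than the second vertex closes an initial segment to a polygon.\<close>

lemma polygon_if_no_leaves:
  assumes "finite V" "V \<noteq> {}" "E \<subseteq> V \<times> V" "sym E" "irrefl E"
    and deg: "\<And>v. v \<in> V \<Longrightarrow> 2 \<le> card (E `` {v})"
  shows "\<exists>vs. polygon E vs"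
proof -
  define P where "P = {xs. set xs \<subseteq> V \<and> distinct xs \<and> xs \<noteq> [] \<and>
    (\<forall>i. Suc i < length xs \<longrightarrow> (xs ! i, xs ! Suc i) \<in> E)}"
  obtain a where "a \<in> V" using assms(2) by blast
  then have "[a] \<in> P" by (simp add: P_def)
  moreover have "length xs \<le> card V" if "xs \<in> P" for xs
    using that assms(1) by (auto simp: P_def card_mono simp flip: distinct_card)
  ultimately obtain xs where xs: "xs \<in> P" and max: "\<And>ys. ys \<in> P \<Longrightarrow> length ys \<le> length xs"
    using ex_has_greatest_nat[of "\<lambda>xs. xs \<in> P" "[a]" length "Suc (card V)"]
    by (metis le_imp_less_Suc)
  have x: "set xs \<subseteq> V" "distinct xs" "xs \<noteq> []"
    "\<And>i. Suc i < length xs \<Longrightarrow> (xs ! i, xs ! Suc i) \<in> E"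
    using xs by (auto simp: P_def)
  have hd: "xs ! 0 \<in> V" using x by (metis hd_conv_nth hd_in_set subsetD)
  have nb: "w \<in> set xs" if "(xs ! 0, w) \<in> E" for w
  proof (rule ccontr)
    assume "w \<notin> set xs"
    then have "w # xs \<in> P"
      using x that assms(3,4) by (auto simp: P_def nth_Cons' sym_def gr0_conv_Suc)
    then show False using max by fastforce
  qed
  have "\<not> E `` {xs ! 0} \<subseteq> {xs ! 1}"
    using deg[OF hd] card_mono[of "{xs ! 1}" "E `` {xs ! 0}"] by auto
  then obtain w where w: "(xs ! 0, w) \<in> E" "w \<noteq> xs ! 1" by blast
  obtain j where j: "j < length xs" "w = xs ! j" using nb[OF w(1)] by (auto simp: in_set_conv_nth)
  have "j \<noteq> 0" 
  proof
    assume "j = 0"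
    then have "(xs ! 0, xs ! 0) \<in> E" using w(1) j(2) by simp
    then show False using assms(5) unfolding irrefl_def by blast
  qed
  moreover have "j \<noteq> 1" using w(2) j by auto
  ultimately have "2 \<le> j" by simp
  have "polygon E (take (Suc j) xs)"
    unfolding polygon_def
  proof (intro conjI allI impI)
    fix i assume i: "i < length (take (Suc j) xs)"
    show "(take (Suc j) xs ! i, take (Suc j) xs ! (Suc i mod length (take (Suc j) xs))) \<in> E"
    proof (cases "i = j")
      case True
      moreover have "length (take (Suc j) xs) = Suc j" using j by simp
      moreover have "(xs ! j, xs ! 0) \<in> E" using w j assms(4) by (auto dest: symD)
      ultimately show ?thesis by simp
    next
      case False
      then show ?thesis using i j x(4)[of i] by (auto simp: min_def)
    qed
  qed (use j x \<open>2 \<le> j\<close> in auto)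
  then show ?thesis by blast
qed

text \<open>By the preceding lemma some vertex has degree at most 1. Deleting it loses at most one
  edge and creates no polygon, so induction on the vertex set applies.\<close>

lemma card_edges_le_if_no_polygon:
  assumes "finite V" "V \<noteq> {}" "E \<subseteq> V \<times> V" "sym E" "irrefl E" "\<nexists>vs. polygon E vs"
  shows "card ((\<lambda>(u, v). {u, v}) ` E) < card V"
  using assms
proof (induction V arbitrary: E rule: finite_psubset_induct)
  case (psubset V)
  let ?e = "\<lambda>(u, v). {u, v}"
  have "\<not> (\<forall>v\<in>V. 2 \<le> card (E `` {v}))"
    using polygon_if_no_leaves[OF psubset.hyps psubset.prems(1-4)] psubset.prems(5) by metis
  then obtain v where v: "v \<in> V" "card (E `` {v}) \<le> 1" by force
  have finE: "finite E" using finite_subset[OF psubset.prems(2)] psubset.hyps by simp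
  define V' where "V' = V - {v}"
  define E' where "E' = E \<inter> V' \<times> V'"
  show ?case
  proof (cases "V' = {}")
    case True
    then have "V = {v}" using v by (auto simp: V'_def)
    then have "E = {}" using psubset.prems(2,4) by (auto simp: irrefl_def)
    then show ?thesis using \<open>V = {v}\<close> by simp
  next
    case False
    have sub: "E' \<subseteq> V' \<times> V'" "E' \<subseteq> E" by (auto simp: E'_def)
    have "sym E'" using psubset.prems(3) by (auto simp: E'_def intro!: symI dest: symD)
    moreover have "irrefl E'" using psubset.prems(4) sub(2) unfolding irrefl_def by blast
    moreover have "\<nexists>vs. polygon E' vs"
      using psubset.prems(5) sub(2) unfolding polygon_def by blast
    moreover have "V' \<subset> V" using v(1) by (auto simp: V'_def)
    ultimately have "card (?e ` E') < card V'" using False sub(1) by (intro psubset.IH)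
    moreover have "?e ` E \<subseteq> (\<lambda>w. {v, w}) ` (E `` {v}) \<union> ?e ` E'"
    proof
      fix e assume "e \<in> ?e ` E"
      then obtain a b where ab: "e = {a, b}" "(a, b) \<in> E" by auto
      have "(b, a) \<in> E" using ab psubset.prems(3) by (auto dest: symD)
      show "e \<in> (\<lambda>w. {v, w}) ` (E `` {v}) \<union> ?e ` E'"
      proof (cases "a = v \<or> b = v")
        case True
        then have "\<exists>w. (v, w) \<in> E \<and> e = {v, w}"
          using ab \<open>(b, a) \<in> E\<close> by (metis insert_commute)
        then show ?thesis by blast
      next
        case False
        then have "(a, b) \<in> E'" using ab psubset.prems(2) by (auto simp: E'_def V'_def)
        then have "e \<in> ?e ` E'" unfolding ab(1) by (intro image_eqI[of _ _ "(a, b)"]) auto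
        then show ?thesis by simp
      qed
    qed
    then have "card (?e ` E) \<le> card ((\<lambda>w. {v, w}) ` (E `` {v}) \<union> ?e ` E')"
      using finE by (intro card_mono) (auto simp: E'_def finite_Image)
    then have "card (?e ` E) \<le> card ((\<lambda>w. {v, w}) ` (E `` {v})) + card (?e ` E')"
      using card_Un_le by (rule le_trans)
    moreover have "card ((\<lambda>w. {v, w}) ` (E `` {v})) \<le> 1"
      using le_trans[OF card_image_le[OF finite_Image[OF finE]] v(2)] .
    moreover have "card V = Suc (card V')"
      using card_Suc_Diff1[OF psubset.hyps v(1)] by (simp add: V'_def)
    ultimately show ?thesis by linarith
  qed
qed

section \<open>Edge imbalances in connected graphs\<close>

locale connected_graph = pair_graph +
  assumes rtrancl: "u \<in> pverts G \<Longrightarrow> v \<in> pverts G \<Longrightarrow> (u, v) \<in> (parcs G)\<^sup>*"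
begin

lemma degree_eq_card: "degree G v = card (parcs G `` {v})"
proof -
  have "snd ` out_arcs (with_proj G) v = parcs G `` {v}"
    by (force simp: out_arcs_def)
  moreover have "inj_on snd (out_arcs (with_proj G) v)"
    by (rule inj_onI) (auto simp: out_arcs_def)
  ultimately show ?thesis
    unfolding degree_def out_degree_def by (metis card_image)
qed

lemma finite_neighbours [simp]: "finite (parcs G `` A)"
  by (rule finite_Image[OF pair_finite_arcs])

lemma no_loop: "(u, u) \<notin> parcs G"
  using pair_no_loops by fastforce

text \<open>This is how connectedness enters the structural arguments: a configuration that no arc
  leaves is the whole graph.\<close>

lemma verts_subset_if_closed:
  assumes "x \<in> X" "x \<in> pverts G" "\<And>a b. (a, b) \<in> parcs G \<Longrightarrow> a \<in> X \<Longrightarrow> b \<in> X"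
  shows "pverts G \<subseteq> X"
proof
  fix y assume "y \<in> pverts G"
  then have "(x, y) \<in> (parcs G)\<^sup>*" using assms(2) rtrancl by blast
  then show "y \<in> X" by induction (use assms in blast)+
qed

section \<open>Natural-number distances and the bound on the imbalance\<close>

definition walk_dist :: "'a \<Rightarrow> 'a \<Rightarrow> nat" where
  "walk_dist u v = (LEAST n. (u, v) \<in> parcs G ^^ n)"

lemma walk_dist_relpow:
  assumes "u \<in> pverts G" "v \<in> pverts G"
  shows "(u, v) \<in> parcs G ^^ walk_dist u v"
  unfolding walk_dist_def using rtrancl[OF assms] by (meson LeastI_ex rtrancl_imp_relpow)

lemma walk_dist_le: "(u, v) \<in> parcs G ^^ n \<Longrightarrow> walk_dist u v \<le> n"
  unfolding walk_dist_def by (rule Least_le)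

lemma walk_dist_self [simp]: "walk_dist u u = 0"
  using walk_dist_le[of u u 0] by simp

lemma closer_eq:
  assumes "u \<in> pverts G" "v \<in> pverts G"
  shows "closer G u v = card {w \<in> pverts G. walk_dist w u < walk_dist w v}"
proof -
  have "dist_graph G w x = ereal (real (walk_dist w x))" if "w \<in> pverts G" "x \<in> pverts G" for w x
    unfolding walk_dist_def using dist_graph_eq_Least[OF that(1) rtrancl[OF that]] .
  then show ?thesis using assms by (auto simp: closer_def intro!: arg_cong[of _ _ card])
qed

lemma walk_dist_pos: "u \<in> pverts G \<Longrightarrow> v \<in> pverts G \<Longrightarrow> u \<noteq> v \<Longrightarrow> 0 < walk_dist u v"
  using walk_dist_relpow[of u v] by (cases "walk_dist u v") auto

lemma closer_pos:
  assumes "(u, v) \<in> parcs G"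
  shows "1 \<le> closer G u v"
proof -
  have uv: "u \<in> pverts G" "v \<in> pverts G" "u \<noteq> v"
    using assms in_arcsD1 in_arcsD2 no_loop by blast+
  then have "card {u} \<le> closer G u v"
    unfolding closer_eq[OF uv(1,2)] using walk_dist_pos pair_finite_verts by (intro card_mono) auto
  then show ?thesis by simp
qed

lemma closer_add_le:
  assumes "(u, v) \<in> parcs G"
  shows "closer G u v + closer G v u \<le> order G"
proof -
  have uv: "u \<in> pverts G" "v \<in> pverts G" using assms in_arcsD1 in_arcsD2 by blast+
  let ?A = "{w \<in> pverts G. walk_dist w u < walk_dist w v}" and ?B = "{w \<in> pverts G. walk_dist w v < walk_dist w u}"
  have "card ?A + card ?B = card (?A \<union> ?B)"
    using pair_finite_verts by (intro card_Un_disjoint[symmetric]) auto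
  also have "\<dots> \<le> order G"
    unfolding order_def using pair_finite_verts by (intro card_mono) auto
  finally show ?thesis using closer_eq uv by simp
qed

lemma imbalance_le:
  assumes "(u, v) \<in> parcs G"
  shows "edge_imbalance G {u, v} \<le> int (order G) - 2"
  using closer_pos[OF assms] closer_pos[OF arcs_symmetric[OF assms]] closer_add_le[OF assms]
  unfolding edge_imbalance_doubleton by linarith

lemma edgesE:
  assumes "e \<in> edges G"
  obtains u v where "e = {u, v}" "(u, v) \<in> parcs G"
  using assms by (auto simp: edges_def)

lemma edgesI: "(u, v) \<in> parcs G \<Longrightarrow> {u, v} \<in> edges G"
  by (force simp: edges_def)

lemma in_edges_iff: "{u, v} \<in> edges G \<longleftrightarrow> (u, v) \<in> parcs G"
proof
  assume "{u, v} \<in> edges G"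
  then obtain a b where "{u, v} = {a, b}" "(a, b) \<in> parcs G" by (rule edgesE)
  then show "(u, v) \<in> parcs G" using arcs_symmetric[of a b] by (auto simp: doubleton_eq_iff)
qed (rule edgesI)

lemma finite_edges: "finite (edges G)"
  using pair_finite_arcs by (simp add: edges_def)

text \<open>A walk from \<open>B\<close> to \<open>v\<close> has to leave \<open>B\<close>, which is
  possible only along the arc from \<open>u\<close> to \<open>v\<close>; so it visits
  \<open>u\<close> at an earlier time.\<close>

lemma walk_dist_less_if_cut:
  assumes "u \<in> B" "v \<notin> B" "w \<in> B" "w \<in> pverts G" "u \<in> pverts G" "v \<in> pverts G"
    and cut: "\<And>a b. (a, b) \<in> parcs G \<Longrightarrow> a \<in> B \<Longrightarrow> b \<notin> B \<Longrightarrow> a = u \<and> b = v"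
  shows "walk_dist w u < walk_dist w v"
proof -
  \<comment> \<open>Claimed for all walks rather than shortest ones, so that the induction can strip
    the first arc.\<close>
  have "\<exists>m<n. (w, u) \<in> parcs G ^^ m" if "(w, v) \<in> parcs G ^^ n" "w \<in> B" for n w
    using that
  proof (induction n arbitrary: w)
    case 0
    then show ?case using assms by auto
  next
    case (Suc n)
    then obtain x where x: "(w, x) \<in> parcs G" "(x, v) \<in> parcs G ^^ n"
      by (meson relpow_Suc_D2)
    show ?case
    proof (cases "x \<in> B")
      case True
      then obtain m where "m < n" "(x, u) \<in> parcs G ^^ m" using Suc.IH x by blast
      then show ?thesis using relpow_Suc_I2[OF x(1)] by (intro exI[of _ "Suc m"]) auto
    next
      case False
      then have "w = u" using cut x Suc.prems by blast
      then show ?thesis by (intro exI[of _ 0]) auto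
    qed
  qed
  from this[OF walk_dist_relpow] show ?thesis using assms walk_dist_le by (meson le_less_trans)
qed

text \<open>If \<open>uv\<close> is the only edge between \<open>B\<close> and its complement, then
  \<open>B\<close> is exactly the set of vertices closer to \<open>u\<close>, and no vertex is
  equidistant. Only the size of \<open>B\<close> matters.\<close>

lemma imbalance_if_cut:
  assumes "(u, v) \<in> parcs G" "u \<in> B" "v \<notin> B" "B \<subseteq> pverts G"
    and cut: "\<And>a b. (a, b) \<in> parcs G \<Longrightarrow> a \<in> B \<Longrightarrow> b \<notin> B \<Longrightarrow> a = u \<and> b = v"
  shows "edge_imbalance G {u, v} = \<bar>int (order G) - 2 * int (card B)\<bar>"
proof -
  have uv: "u \<in> pverts G" "v \<in> pverts G" using assms(1) in_arcsD1 in_arcsD2 by blast+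
  have "walk_dist w u < walk_dist w v" if "w \<in> B" for w
    using walk_dist_less_if_cut[of u B v w] cut assms that uv by blast
  moreover have "walk_dist w v < walk_dist w u" if "w \<in> pverts G - B" for w
  proof (rule walk_dist_less_if_cut[of v "- B" u w])
    show "a = v \<and> b = u" if "(a, b) \<in> parcs G" "a \<in> - B" "b \<notin> - B" for a b
      using cut[OF arcs_symmetric[OF that(1)]] that by blast
  qed (use that assms uv in blast)+
  ultimately have "w \<in> B \<longleftrightarrow> walk_dist w u < walk_dist w v" "w \<in> pverts G - B \<longleftrightarrow> walk_dist w v < walk_dist w u"
    if "w \<in> pverts G" for w
    using that by (metis DiffI DiffD2 less_asym)+
  then have "{w \<in> pverts G. walk_dist w u < walk_dist w v} = B" "{w \<in> pverts G. walk_dist w v < walk_dist w u} = pverts G - B"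
    using assms(4) by blast+
  then have "closer G u v = card B" "closer G v u = order G - card B"
    using closer_eq uv assms(4) pair_finite_verts
    by (auto simp: order_def card_Diff_subset finite_subset)
  moreover have "card B \<le> order G"
    unfolding order_def using assms(4) pair_finite_verts by (rule card_mono[rotated])
  ultimately show ?thesis unfolding edge_imbalance_doubleton by (simp add: of_nat_diff)
qed

lemma degree_1_neighbours:
  assumes "(u, v) \<in> parcs G" "degree G u = 1"
  shows "parcs G `` {u} = {v}"
proof -
  obtain x where "parcs G `` {u} = {x}"
    using assms(2) unfolding degree_eq_card by (rule card_1_singletonE)
  then show ?thesis using assms(1) by auto
qed

lemma imbalance_leaf:
  assumes "(u, v) \<in> parcs G" "degree G u = 1"
  shows "edge_imbalance G {u, v} = \<bar>int (order G) - 2\<bar>"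
proof -
  have "edge_imbalance G {u, v} = \<bar>int (order G) - 2 * int (card {u})\<bar>"
  proof (rule imbalance_if_cut)
    show "a = u \<and> b = v" if "(a, b) \<in> parcs G" "a \<in> {u}" "b \<notin> {u}" for a b
      using degree_1_neighbours[OF assms] that by blast
  qed (use assms(1) no_loop in_arcsD1 in blast)+
  then show ?thesis by simp
qed

text \<open>A second neighbour \<open>w\<close> of \<open>u\<close> is not adjacent to
  \<open>v\<close>, as \<open>u\<close>, \<open>w\<close>, \<open>v\<close> would form a triangle.
  Hence \<open>w\<close> has distance at least 2 from \<open>v\<close> and at most 1 from
  \<open>u\<close>, and is counted next to \<open>u\<close> itself.\<close>

lemma closer_eq_1_imp_leaf:
  assumes "(u, v) \<in> parcs G" "closer G u v = 1" "\<nexists>vs. polygon (parcs G) vs"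
  shows "degree G u = 1"
proof -
  have uv: "u \<in> pverts G" "v \<in> pverts G" "u \<noteq> v"
    using assms(1) in_arcsD1 in_arcsD2 no_loop by blast+
  obtain x where "{w \<in> pverts G. walk_dist w u < walk_dist w v} = {x}"
    using assms(2) closer_eq[OF uv(1,2)] by (metis card_1_singletonE)
  moreover have "u \<in> {w \<in> pverts G. walk_dist w u < walk_dist w v}" using walk_dist_pos uv by simp
  ultimately have x: "{w \<in> pverts G. walk_dist w u < walk_dist w v} = {u}" by (metis singletonD)
  have "w = v" if w: "(u, w) \<in> parcs G" for w
  proof (rule ccontr)
    assume "w \<noteq> v"
    have wV: "w \<in> pverts G" "w \<noteq> u" using w in_arcsD2 no_loop by blast+
    have "(w, v) \<notin> parcs G"
    proof
      assume "(w, v) \<in> parcs G"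
      then have "polygon (parcs G) [u, w, v]"
        using w arcs_symmetric[OF assms(1)] \<open>w \<noteq> v\<close> uv wV
        by (auto simp: polygon_def less_Suc_eq)
      then show False using assms(3) by blast
    qed
    then have "walk_dist w v \<noteq> 1" using walk_dist_relpow[of w v] wV uv by auto
    then have "1 < walk_dist w v" using walk_dist_pos[of w v] wV uv \<open>w \<noteq> v\<close> by simp
    moreover have "walk_dist w u \<le> 1" using walk_dist_le[of w u 1] arcs_symmetric[OF w] by simp
    ultimately have "w \<in> {w \<in> pverts G. walk_dist w u < walk_dist w v}" using wV by simp
    then show False using x \<open>w \<noteq> u\<close> by simp
  qed
  then have "parcs G `` {u} = {v}" using assms(1) by blast
  then show ?thesis by (simp add: degree_eq_card)
qed

lemma leaf_if_imbalance:
  assumes "(u, v) \<in> parcs G" "edge_imbalance G {u, v} = int (order G) - 2"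
    "\<nexists>vs. polygon (parcs G) vs"
  shows "degree G u = 1 \<or> degree G v = 1"
proof -
  have "closer G u v = 1 \<or> closer G v u = 1"
    using closer_pos[OF assms(1)] closer_pos[OF arcs_symmetric[OF assms(1)]]
      closer_add_le[OF assms(1)] assms(2)
    unfolding edge_imbalance_doubleton by linarith
  then show ?thesis using closer_eq_1_imp_leaf assms arcs_symmetric by blast
qed

end

section \<open>Pendent paths\<close>

lemma set_vwalk_arcs: "set (vwalk_arcs p) = {(p ! i, p ! Suc i) | i. Suc i < length p}"
proof (induction p rule: vwalk_arcs.induct)
  case (3 x y xs)
  have "{(f i, f (Suc i)) | i. Suc i < Suc m} =
      insert (f 0, f 1) {(f (Suc i), f (Suc (Suc i))) | i. Suc i < m}"
    if "0 < m" for m and f :: "nat \<Rightarrow> 'a"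
    using that by (auto simp: gr0_conv_Suc) (metis not0_implies_Suc less_Suc_eq_0_disj)+
  from this[of "length (y # xs)" "(!) (x # y # xs)"] 3 show ?case by simp
qed auto

context connected_graph
begin

text \<open>The end \<open>p ! r\<close> is left out because several pendent paths may share it; the
  bodies are the parts that turn out to be disjoint.\<close>

definition body :: "nat \<Rightarrow> 'a list \<Rightarrow> 'a set" where
  "body r p = (!) p ` {..<r}"

lemma pendent_path_iff:
  "pendent_path G r p \<longleftrightarrow> 1 \<le> r \<and> length p = Suc r \<and> distinct p \<and> set p \<subseteq> pverts G \<and>
     (\<forall>i<r. (p ! i, p ! Suc i) \<in> parcs G) \<and>
     degree G (p ! 0) = 1 \<and> 2 \<le> degree G (p ! r) \<and>
     (\<forall>i. 1 \<le> i \<and> i \<le> r - 1 \<longrightarrow> degree G (p ! i) = 2)"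
proof -
  have "set (vwalk_arcs p) \<subseteq> parcs G \<longleftrightarrow> (\<forall>i. Suc i < length p \<longrightarrow> (p ! i, p ! Suc i) \<in> parcs G)"
    by (auto simp: set_vwalk_arcs)
  moreover have "p \<noteq> [] \<and> length p - 1 = r \<longleftrightarrow> length p = Suc r" by (cases p) auto
  ultimately show ?thesis
    by (auto simp: pendent_path_def vpath_def vwalk_def)
qed

context
  fixes r p assumes p: "pendent_path G r p"
begin

lemma pendent_pathD:
  shows "1 \<le> r" "length p = Suc r" "distinct p" "set p \<subseteq> pverts G"
    and "\<And>i. i < r \<Longrightarrow> (p ! i, p ! Suc i) \<in> parcs G"
  using p by (auto simp: pendent_path_iff)

lemma pendent_path_nth_eq_iff: "i \<le> r \<Longrightarrow> j \<le> r \<Longrightarrow> p ! i = p ! j \<longleftrightarrow> i = j"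
  using pendent_pathD(2,3) by (simp add: nth_eq_iff_index_eq)

lemma pendent_path_nth_in_verts: "i \<le> r \<Longrightarrow> p ! i \<in> pverts G"
  using pendent_pathD(2,4) by (metis le_imp_less_Suc nth_mem subsetD)

lemma pendent_path_start_neighbours: "parcs G `` {p ! 0} = {p ! 1}"
  using degree_1_neighbours[of "p ! 0" "p ! 1"] pendent_pathD(5)[of 0] p
  by (auto simp: pendent_path_iff)

lemma pendent_path_inner_neighbours:
  assumes "1 \<le> i" "i < r"
  shows "parcs G `` {p ! i} = {p ! (i - 1), p ! Suc i}"
proof (rule card_seteq[symmetric])
  have "(p ! i, p ! (i - 1)) \<in> parcs G"
    using pendent_pathD(5)[of "i - 1"] assms arcs_symmetric by simp
  then show "{p ! (i - 1), p ! Suc i} \<subseteq> parcs G `` {p ! i}"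
    using pendent_pathD(5)[of i] assms by blast
  have "degree G (p ! i) = 2" using p assms by (simp add: pendent_path_iff)
  moreover have "p ! (i - 1) \<noteq> p ! Suc i"
    using pendent_path_nth_eq_iff[of "i - 1" "Suc i"] assms by simp
  ultimately show "card (parcs G `` {p ! i}) \<le> card {p ! (i - 1), p ! Suc i}"
    by (simp add: degree_eq_card)
qed simp

lemma pendent_path_neighbours:
  assumes "i < r" "(p ! i, w) \<in> parcs G"
  shows "w = p ! Suc i \<or> 1 \<le> i \<and> w = p ! (i - 1)"
proof (cases "i = 0")
  case True
  then show ?thesis using assms(2) pendent_path_start_neighbours by auto
next
  case False
  then show ?thesis using assms pendent_path_inner_neighbours[of i] by auto
qed

text \<open>All vertices before the end have their neighbours on the path, so an initial segment can
  be left only at its last vertex. This supplies the cut hypothesis of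
  \<open>imbalance_if_cut\<close>.\<close>

lemma pendent_path_segment_cut:
  assumes "i < r" "(a, b) \<in> parcs G" "a \<in> (!) p ` {..i}" "b \<notin> (!) p ` {..i}"
  shows "a = p ! i \<and> b = p ! Suc i"
proof -
  obtain j where j: "j \<le> i" "a = p ! j" using assms(3) by auto
  then have "b = p ! Suc j \<or> 1 \<le> j \<and> b = p ! (j - 1)"
    using pendent_path_neighbours[of j b] assms by simp
  moreover have "b \<noteq> p ! (j - 1)" using assms(4) j by auto
  moreover have "j = i" if "b = p ! Suc j"
    using assms(4) j that by (metis atMost_iff image_eqI le_antisym not_less_eq_eq)
  ultimately show ?thesis using j by auto
qed

lemma pendent_path_body_cut:
  assumes "(a, b) \<in> parcs G" "a \<in> body r p" "b \<notin> body r p"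
  shows "a = p ! (r - 1) \<and> b = p ! r"
proof -
  have "{..<r} = {..r - 1}" using pendent_pathD(1) by auto
  then show ?thesis
    using pendent_path_segment_cut[of "r - 1" a b] assms pendent_pathD(1) by (simp add: body_def)
qed

lemma body_subset: "body r p \<subseteq> pverts G"
  using pendent_path_nth_in_verts by (auto simp: body_def)

lemma finite_body: "finite (body r p)" by (simp add: body_def)

lemma card_body: "card (body r p) = r"
proof -
  have "inj_on ((!) p) {..<r}" by (rule inj_onI) (simp add: pendent_path_nth_eq_iff)
  then show ?thesis by (simp add: body_def card_image)
qed

lemma pendent_path_end_notin_body: "p ! r \<notin> body r p"
  by (auto simp: body_def pendent_path_nth_eq_iff)

text \<open>The edge at index \<open>i\<close> cuts off the i + 1 vertices \<open>p ! 0\<close>,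
  ..., \<open>p ! i\<close>; the index starts at 0, hence the summand 1.\<close>

lemma imbalance_pendent_path:
  assumes "i < r"
  shows "edge_imbalance G {p ! i, p ! Suc i} = \<bar>int (order G) - 2 * (int i + 1)\<bar>"
proof -
  have "inj_on ((!) p) {..i}" by (rule inj_onI) (use assms in \<open>simp add: pendent_path_nth_eq_iff\<close>)
  then have "card ((!) p ` {..i}) = Suc i" by (simp add: card_image)
  moreover have "edge_imbalance G {p ! i, p ! Suc i} = \<bar>int (order G) - 2 * int (card ((!) p ` {..i}))\<bar>"
  proof (rule imbalance_if_cut)
    show "p ! Suc i \<notin> (!) p ` {..i}" using assms by (auto simp: pendent_path_nth_eq_iff)
    show "(!) p ` {..i} \<subseteq> pverts G" using pendent_path_nth_in_verts assms by auto
  qed (use assms pendent_pathD(5) pendent_path_segment_cut[OF assms] in auto)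
  ultimately show ?thesis by simp
qed

end

text \<open>The leaf determines the path: it has one neighbour, and at each later inner vertex the
  predecessor is known, so the other of its two neighbours comes next.\<close>

lemma pendent_path_eqI:
  assumes p: "pendent_path G r p" and q: "pendent_path G r q" and "p ! 0 = q ! 0"
  shows "p = q"
proof (rule nth_equalityI)
  show "length p = length q" using pendent_pathD(2)[OF p] pendent_pathD(2)[OF q] by simp
  have "p ! i = q ! i" if "i \<le> r" for i
    using that
  proof (induction i rule: less_induct)
    case (less i)
    consider "i = 0" | "i = 1" | j where "i = Suc j" "1 \<le> j" by (cases i; cases "i - 1") auto
    then show ?case
    proof cases
      case 2
      then show ?thesis
        using pendent_path_start_neighbours[OF p] pendent_path_start_neighbours[OF q] assms(3) by simp
    next
      case (3 j)
      then have "{p ! (j - 1), p ! Suc j} = {q ! (j - 1), q ! Suc j}"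
        using less pendent_path_inner_neighbours[OF p, of j] pendent_path_inner_neighbours[OF q, of j]
        by simp
      moreover have "p ! (j - 1) = q ! (j - 1)" using less 3 by simp
      ultimately show ?thesis using 3 by (auto simp: doubleton_eq_iff)
    qed (use assms(3) in simp)
  qed
  then show "p ! i = q ! i" if "i < length p" for i
    using that pendent_pathD(2)[OF p] by simp
qed

text \<open>Each body can be left only towards its end, which here lies in the other body. So the
  union of the two bodies is closed under adjacency and exhausts the graph.\<close>

lemma order_le_if_closed:
  assumes p: "pendent_path G r p" and q: "pendent_path G r q"
    and "p ! r \<in> body r q" "q ! r \<in> body r p"
  shows "order G \<le> 2 * r"
proof -
  have "pverts G \<subseteq> body r p \<union> body r q"
  proof (rule verts_subset_if_closed[of "p ! 0"])
    show "p ! 0 \<in> body r p \<union> body r q" using pendent_pathD(1)[OF p] by (simp add: body_def)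
    show "p ! 0 \<in> pverts G" using pendent_path_nth_in_verts[OF p] by simp
    show "b \<in> body r p \<union> body r q" if "(a, b) \<in> parcs G" "a \<in> body r p \<union> body r q" for a b
      using that pendent_path_body_cut[OF p, of a b] pendent_path_body_cut[OF q, of a b] assms(3,4)
      by blast
  qed
  then have "order G \<le> card (body r p \<union> body r q)"
    unfolding order_def by (intro card_mono) (simp_all add: finite_body[OF p] finite_body[OF q])
  also have "\<dots> \<le> 2 * r"
    using card_Un_le[of "body r p" "body r q"] card_body[OF p] card_body[OF q] by simp
  finally show ?thesis .
qed

text \<open>Walking along one of the paths, the boundary edge of the other body is crossed at most once.\<close>

lemma pendent_paths_disjoint:
  assumes p: "pendent_path G r p" and q: "pendent_path G r q" and "p \<noteq> q" "2 * r < order G"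
  shows "body r p \<inter> body r q = {}"
proof (rule ccontr)
  assume "body r p \<inter> body r q \<noteq> {}"
  then obtain i0 where i0: "i0 < r" "p ! i0 \<in> body r q" by (auto simp: body_def)
  define i where "i = (LEAST i. p ! i \<in> body r q)"
  have i: "p ! i \<in> body r q" "i < r" and least: "\<And>j. j < i \<Longrightarrow> p ! j \<notin> body r q"
    unfolding i_def
    using i0 LeastI[of "\<lambda>i. p ! i \<in> body r q"] Least_le[of "\<lambda>i. p ! i \<in> body r q" i0]
    by (auto dest: not_less_Least)
  \<comment> \<open>The only leaf in the body of \<open>q\<close> is \<open>q ! 0\<close>, and a
    common starting leaf would give p = q.\<close>
  have "p ! 0 \<notin> body r q"
  proof
    assume "p ! 0 \<in> body r q"
    then obtain j where j: "j < r" "p ! 0 = q ! j" by (auto simp: body_def)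
    have "j \<noteq> 0" using pendent_path_eqI[OF p q] j assms(3) by metis
    then have "degree G (q ! j) = 2" using q j by (simp add: pendent_path_iff)
    moreover have "degree G (p ! 0) = 1" using p by (simp add: pendent_path_iff)
    ultimately show False using j by simp
  qed
  then have "i \<noteq> 0" using i by metis
  then have "p ! (i - 1) \<notin> body r q" "(p ! i, p ! (i - 1)) \<in> parcs G"
    using least[of "i - 1"] pendent_pathD(5)[OF p, of "i - 1"] i arcs_symmetric by simp_all
  \<comment> \<open>Read backwards, the arc by which \<open>p\<close> first enters the body of
    \<open>q\<close> leaves that body, so it is the boundary arc of \<open>q\<close>.\<close>
  then have enter: "p ! i = q ! (r - 1)" "p ! (i - 1) = q ! r"
    using pendent_path_body_cut[OF q, of "p ! i" "p ! (i - 1)"] i by simp_all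
  \<comment> \<open>To get out again \<open>p\<close> would have to pass \<open>q ! r\<close>, which
    it already used at index i - 1.\<close>
  have "p ! j \<in> body r q" if "i \<le> j" "j \<le> r" for j
    using that
  proof (induction j rule: dec_induct)
    case base
    show ?case by (rule i)
  next
    case (step j)
    then have "p ! j \<in> body r q" "(p ! j, p ! Suc j) \<in> parcs G"
      using pendent_pathD(5)[OF p] by simp_all
    moreover have "p ! Suc j \<noteq> q ! r"
      using enter(2) pendent_path_nth_eq_iff[OF p, of "Suc j" "i - 1"] step i by simp
    ultimately show ?case using pendent_path_body_cut[OF q] by blast
  qed
  then have "p ! r \<in> body r q" using i by simp
  moreover have "q ! r \<in> body r p" unfolding enter(2)[symmetric] using i by (auto simp: body_def)
  ultimately show False using order_le_if_closed[OF p q] assms(4) by simp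
qed

text \<open>If the end of \<open>p\<close> lay in the body of \<open>q\<close>, the last edge of
  \<open>p\<close> would leave that body by disjointness. Then \<open>q ! r\<close> is
  \<open>p ! (r - 1)\<close>, and \<open>order_le_if_closed\<close> contradicts the order.\<close>

lemma pendent_path_end_notin_other_body:
  assumes p: "pendent_path G r p" and q: "pendent_path G r q" and "2 * r < order G" "p \<noteq> q"
  shows "p ! r \<notin> body r q"
proof
  assume pr: "p ! r \<in> body r q"
  have "p ! (r - 1) \<in> body r p" using pendent_pathD(1)[OF p] by (auto simp: body_def)
  moreover from this have "p ! (r - 1) \<notin> body r q"
    using pendent_paths_disjoint[OF p q assms(4,3)] by blast
  moreover have "(p ! r, p ! (r - 1)) \<in> parcs G"
    using pendent_pathD(5)[OF p, of "r - 1"] pendent_pathD(1)[OF p] arcs_symmetric by simp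
  ultimately have "q ! r \<in> body r p" using pendent_path_body_cut[OF q _ pr] by metis
  then show False using order_le_if_closed[OF p q pr] assms(3) by simp
qed

end

text \<open>The inequality is demanded only in the presence of two distinct paths: then k \<ge> 2
  and it follows from k r + 2 \<le> n, whereas for a single path it may fail.\<close>

locale separated_pendent_paths = connected_graph +
  fixes r :: nat
  assumes sep: "pendent_path G r p \<Longrightarrow> pendent_path G r q \<Longrightarrow> p \<noteq> q \<Longrightarrow> 2 * r < order G"
begin

section \<open>Splitting the Mostar index along the pendent paths\<close>

abbreviation paths :: "'a list set" where
  "paths \<equiv> {p. pendent_path G r p}"

definition path_edges :: "'a set set" where
  "path_edges = (\<lambda>(p, i). {p ! i, p ! Suc i}) ` (paths \<times> {..<r})"

definition bodies :: "'a set" where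
  "bodies = (\<Union>p\<in>paths. body r p)"

lemma finite_paths: "finite paths"
proof (rule finite_subset)
  show "paths \<subseteq> {xs. set xs \<subseteq> pverts G \<and> length xs = Suc r}"
    using pendent_pathD(2,4) by blast
qed (simp add: finite_lists_length_eq pair_finite_verts)

lemma end_notin_bodies: "p \<in> paths \<Longrightarrow> p ! r \<notin> bodies"
  using sep pendent_path_end_notin_other_body pendent_path_end_notin_body
  unfolding bodies_def by blast

lemma paths_eq_if_common: "p \<in> paths \<Longrightarrow> q \<in> paths \<Longrightarrow> x \<in> body r p \<Longrightarrow> x \<in> body r q \<Longrightarrow> p = q"
  using sep pendent_paths_disjoint by blast

text \<open>Every path edge has a vertex in the body of its path. Bodies are disjoint and contain no
  ends, so the edge determines the path, and then the position.\<close>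

lemma inj_on_path_edges: "inj_on (\<lambda>(p, i). {p ! i, p ! Suc i}) (paths \<times> {..<r})"
proof (rule inj_onI, clarify)
  fix p q i j
  assume p: "pendent_path G r p" "i < r" and q: "pendent_path G r q" "j < r"
    and eq: "{p ! i, p ! Suc i} = {q ! j, q ! Suc j}"
  have inb: "p ! i \<in> body r p" using p by (simp add: body_def)
  have "p ! i \<in> body r q"
  proof (cases "Suc j = r")
    case True
    then have "p ! i \<noteq> q ! Suc j" using end_notin_bodies[of q] q p inb by (auto simp: bodies_def)
    then show ?thesis using eq q by (auto simp: body_def doubleton_eq_iff)
  next
    case False
    then show ?thesis using eq q by (auto simp: body_def doubleton_eq_iff)
  qed
  then have "p = q" using paths_eq_if_common p q inb by blast
  moreover from this have "i = j"
    using eq p q pendent_path_nth_eq_iff[OF q(1)] by (auto simp: doubleton_eq_iff)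
  ultimately show "p = q \<and> i = j" by simp
qed

lemma card_path_edges: "card path_edges = card paths * r"
  unfolding path_edges_def by (simp add: card_image[OF inj_on_path_edges] card_cartesian_product)

lemma path_edges_subset: "path_edges \<subseteq> edges G"
  using pendent_pathD(5) by (auto simp: path_edges_def intro!: edgesI)

text \<open>The first summand depends only on the order, \<open>r\<close> and the number of paths,
  so competing trees differ only in the second.\<close>

lemma mostar_eq:
  "mostar G = int (card paths) * (\<Sum>i<r. \<bar>int (order G) - 2 * (int i + 1)\<bar>) +
    (\<Sum>e\<in>edges G - path_edges. edge_imbalance G e)"
proof -
  have "mostar G = (\<Sum>e\<in>path_edges. edge_imbalance G e) + (\<Sum>e\<in>edges G - path_edges. edge_imbalance G e)"
    unfolding mostar_def using sum.subset_diff[OF path_edges_subset finite_edges] by (simp add: add.commute)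
  also have "(\<Sum>e\<in>path_edges. edge_imbalance G e) =
      (\<Sum>(p, i)\<in>paths \<times> {..<r}. edge_imbalance G {p ! i, p ! Suc i})"
    unfolding path_edges_def sum.reindex[OF inj_on_path_edges] by (simp add: case_prod_unfold comp_def)
  also have "\<dots> = (\<Sum>(p, i)\<in>paths \<times> {..<r}. \<bar>int (order G) - 2 * (int i + 1)\<bar>)"
    by (intro sum.cong) (auto simp: imbalance_pendent_path)
  also have "\<dots> = int (card paths) * (\<Sum>i<r. \<bar>int (order G) - 2 * (int i + 1)\<bar>)"
    by (simp add: sum.cartesian_product[symmetric])
  finally show ?thesis .
qed

lemma card_bodies: "card bodies = card paths * r"
proof -
  have "card bodies = (\<Sum>p\<in>paths. card (body r p))"
    unfolding bodies_def
    using finite_paths paths_eq_if_common by (intro card_UN_disjoint) (auto simp: finite_body)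
  then show ?thesis by (simp add: card_body)
qed

lemma bodies_subset: "bodies \<subseteq> pverts G"
  using body_subset by (auto simp: bodies_def)

lemma path_edges_disjoint:
  assumes "a \<notin> bodies" "b \<notin> bodies"
  shows "{a, b} \<notin> path_edges"
proof
  assume "{a, b} \<in> path_edges"
  then obtain p i where "{a, b} = {p ! i, p ! Suc i}" "p \<in> paths" "i < r"
    by (auto simp: path_edges_def)
  then show False using assms by (auto simp: bodies_def body_def doubleton_eq_iff)
qed

end

section \<open>The extremal tree\<close>

text \<open>At a vertex of the polygon where \<open>f\<close> is largest, both polygon neighbours
  have rank at most that of the vertex. They would coincide, which distinctness and length at least
  3 exclude.\<close>

lemma no_polygon_if_unique_lower_neighbour:
  fixes f :: "'a \<Rightarrow> nat"
  assumes "sym E"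
    and unique: "\<And>a b b'. (a, b) \<in> E \<Longrightarrow> (a, b') \<in> E \<Longrightarrow> f b \<le> f a \<Longrightarrow> f b' \<le> f a \<Longrightarrow> b = b'"
  shows "\<not> polygon E vs"
proof
  assume "polygon E vs"
  then have len: "3 \<le> length vs" and dist: "distinct vs"
    and arc: "\<And>i. i < length vs \<Longrightarrow> (vs ! i, vs ! (Suc i mod length vs)) \<in> E"
    by (auto simp: polygon_def)
  define m where "m = length vs"
  obtain i where i: "i < m" and max: "\<And>j. j < m \<Longrightarrow> f (vs ! j) \<le> f (vs ! i)"
  proof -
    have "Max ((\<lambda>i. f (vs ! i)) ` {..<m}) \<in> (\<lambda>i. f (vs ! i)) ` {..<m}"
      using len by (intro Max_in) (auto simp: m_def lessThan_empty_iff)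
    then obtain i where "i < m" "f (vs ! i) = Max ((\<lambda>i. f (vs ! i)) ` {..<m})" by auto
    then show ?thesis using that by simp
  qed
  \<comment> \<open>The cyclic predecessor of \<open>i\<close>.\<close>
  define j where "j = (if i = 0 then m - 1 else i - 1)"
  have j: "j < m" "Suc j mod m = i" using i by (auto simp: j_def)
  have "(vs ! i, vs ! j) \<in> E" using arc[of j] j assms(1) by (auto simp: m_def dest: symD)
  moreover have "(vs ! i, vs ! (Suc i mod m)) \<in> E" using arc i by (simp add: m_def)
  moreover have l: "Suc i mod m < m" using i by simp
  ultimately have "vs ! j = vs ! (Suc i mod m)" using unique max j by blast
  then have "j = Suc i mod m" using dist j l by (simp add: m_def nth_eq_iff_index_eq)
  moreover have "Suc i mod m = (if Suc i = m then 0 else Suc i)" using i by simp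
  ultimately show False using len i by (auto simp: j_def m_def split: if_splits)
qed

text \<open>A copy of the extremal tree on an arbitrary vertex type, so that it can be compared with
  a tree that is maximal among trees on that type.\<close>

definition S_image :: "(nat \<Rightarrow> 'a) \<Rightarrow> nat \<Rightarrow> nat \<Rightarrow> nat \<Rightarrow> 'a pair_pre_digraph" where
  "S_image g n k r = \<lparr> pverts = g ` {..<n}, parcs = map_prod g g ` parcs (S_tree n k r) \<rparr>"

lemma S_parent_less: "1 \<le> j \<Longrightarrow> S_parent k r j < j"
  by (auto simp: S_parent_def)

lemma S_tree_parcs_iff:
  "(a, b) \<in> parcs (S_tree n k r) \<longleftrightarrow>
     1 \<le> a \<and> a < n \<and> b = S_parent k r a \<or> 1 \<le> b \<and> b < n \<and> a = S_parent k r b"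
  by (auto simp: S_tree_def)

lemma S_tree_parcs_less: "(a, b) \<in> parcs (S_tree n k r) \<Longrightarrow> a < n \<and> b < n"
  using S_parent_less[of a k r] S_parent_less[of b k r] by (auto simp: S_tree_parcs_iff)

lemma digraph_iso_S_image:
  assumes "inj_on g {..<n}"
  shows "digraph_iso (with_proj (S_image g n k r)) (with_proj (S_tree n k r))"
proof -
  define h where "h = the_inv_into {..<n} g"
  have h: "h (g a) = a" if "a < n" for a
    using that assms by (simp add: h_def the_inv_into_f_f)
  let ?f = "\<lparr> iso_verts = h, iso_arcs = map_prod h h, iso_head = snd, iso_tail = fst \<rparr>"
  let ?G = "with_proj (S_image g n k r)"
  have arcs: "map_prod h h (map_prod g g e) = e" if "e \<in> parcs (S_tree n k r)" for e
    using that S_tree_parcs_less[of "fst e" "snd e"] h by (cases e) auto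
  have "wf_digraph ?G"
    by unfold_locales (auto simp: S_image_def dest: S_tree_parcs_less)
  moreover have "inj_on h (pverts (S_image g n k r))"
    by (auto simp: S_image_def inj_on_def h)
  moreover have "inj_on (map_prod h h) (parcs (S_image g n k r))"
    by (rule inj_on_inverseI[of _ "map_prod g g"]) (auto simp: S_image_def h dest: S_tree_parcs_less)
  ultimately have "pre_digraph.digraph_isomorphism ?G ?f"
    by (auto simp: pre_digraph.digraph_isomorphism_def)
  moreover have "h ` g ` {..<n} = {..<n}" using h by force
  moreover have "map_prod h h ` map_prod g g ` parcs (S_tree n k r) = parcs (S_tree n k r)"
    using arcs by force
  ultimately show ?thesis
    unfolding digraph_iso_def
    by (intro exI[of _ ?f]) (auto simp: app_iso_def with_proj_def S_image_def S_tree_def)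
qed

text \<open>The inequalities leave at least one leaf at the centre, and at least two when k = 1; in
  both cases the centre gets degree at least 3.\<close>

locale S_copy =
  fixes g :: "nat \<Rightarrow> 'a" and n k r :: nat
  assumes inj: "inj_on g {..<n}" and k: "1 \<le> k" and r: "2 \<le> r"
    and n: "k * r + 2 \<le> n" "k = 1 \<Longrightarrow> r + 3 \<le> n"
begin

abbreviation G :: "'a pair_pre_digraph" where
  "G \<equiv> S_image g n k r"

abbreviation parent :: "nat \<Rightarrow> nat" where
  "parent \<equiv> S_parent k r"

lemma g_eq_iff: "a < n \<Longrightarrow> b < n \<Longrightarrow> g a = g b \<longleftrightarrow> a = b"
  using inj by (auto simp: inj_on_def)

lemma arc_iff: "a < n \<Longrightarrow> b < n \<Longrightarrow> (g a, g b) \<in> parcs G \<longleftrightarrow> (a, b) \<in> parcs (S_tree n k r)"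
proof
  assume ab: "a < n" "b < n" "(g a, g b) \<in> parcs G"
  then obtain a' b' where "g a = g a'" "g b = g b'" "(a', b') \<in> parcs (S_tree n k r)"
    by (auto simp: S_image_def)
  moreover from this have "a' < n" "b' < n" using S_tree_parcs_less by blast+
  ultimately show "(a, b) \<in> parcs (S_tree n k r)" using ab g_eq_iff by simp
qed (force simp: S_image_def)

lemma arcE:
  assumes "(x, y) \<in> parcs G"
  obtains a b where "x = g a" "y = g b" "a < n" "b < n" "(a, b) \<in> parcs (S_tree n k r)"
  using assms S_tree_parcs_less by (force simp: S_image_def)

lemma arc_sym: "(x, y) \<in> parcs G \<Longrightarrow> (y, x) \<in> parcs G"
  by (elim arcE) (auto simp: arc_iff S_tree_parcs_iff)

lemma verts: "pverts G = g ` {..<n}"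
  by (simp add: S_image_def)

lemma order: "order G = n"
  using inj by (simp add: order_def verts card_image)

lemma pair_graph: "pair_graph G"
proof
  have "parcs (S_tree n k r) \<subseteq> {..<n} \<times> {..<n}" using S_tree_parcs_less by auto
  then have "finite (parcs (S_tree n k r))" by (rule finite_subset) simp
  then show "finite (parcs G)" by (simp add: S_image_def)
  show "finite (pverts G)" by (simp add: verts)
  show "fst e \<in> pverts G" "snd e \<in> pverts G" if "e \<in> parcs G" for e
    using that by (cases e; auto simp: verts elim: arcE)+
  show "fst e \<noteq> snd e" if "e \<in> parcs G" for e
  proof
    assume "fst e = snd e"
    then have "(fst e, fst e) \<in> parcs G" using that by (metis prod.collapse)
    then obtain a where "(a, a) \<in> parcs (S_tree n k r)" by (elim arcE) (auto simp: g_eq_iff)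
    then show False using S_parent_less[of a k r] by (auto simp: S_tree_parcs_iff)
  qed
  show "symmetric (with_proj G)"
    using arc_sym by (auto simp: symmetric_def sym_def)
qed

lemma parent_arc: "1 \<le> j \<Longrightarrow> j < n \<Longrightarrow> (g j, g (parent j)) \<in> parcs G"
  using S_parent_less[of j k r] by (subst arc_iff) (auto simp: S_tree_parcs_iff)

lemma reach_centre: "j < n \<Longrightarrow> (g j, g 0) \<in> (parcs G)\<^sup>*"
proof (induction j rule: less_induct)
  case (less j)
  show ?case
  proof (cases "j = 0")
    case False
    then have "(g (parent j), g 0) \<in> (parcs G)\<^sup>*" using less S_parent_less[of j k r] by simp
    then show ?thesis using parent_arc[of j] False less.prems by (meson converse_rtrancl_into_rtrancl less_one not_less)
  qed simp
qed

lemma rtrancl_verts: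
  assumes "u \<in> pverts G" "v \<in> pverts G"
  shows "(u, v) \<in> (parcs G)\<^sup>*"
proof -
  have "sym ((parcs G)\<^sup>*)" using arc_sym by (intro sym_rtrancl symI)
  then have "(g 0, v) \<in> (parcs G)\<^sup>*" using assms(2) reach_centre verts by (auto dest: symD)
  moreover have "(u, g 0) \<in> (parcs G)\<^sup>*" using assms(1) reach_centre verts by auto
  ultimately show ?thesis by (rule rtrancl_trans[rotated])
qed

end

lemma (in S_copy) connected_graph_S_image: "connected_graph (S_image g n k r)"
  by (intro connected_graph.intro pair_graph connected_graph_axioms.intro rtrancl_verts)

sublocale S_copy \<subseteq> connected_graph "S_image g n k r"
  by (rule connected_graph_S_image)

context S_copy
begin

text \<open>The number of a vertex serves as its rank: parents have smaller numbers and children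
  larger ones, so the parent is the only lower neighbour.\<close>

lemma no_polygon: "\<not> polygon (parcs G) vs"
proof (rule no_polygon_if_unique_lower_neighbour)
  show "sym (parcs G)" using arc_sym by (rule symI)
  define h where "h = the_inv_into {..<n} g"
  have h: "h (g a) = a" if "a < n" for a
    using that inj by (simp add: h_def the_inv_into_f_f)
  have "y = g (parent (h x))" if "(x, y) \<in> parcs G" "h y \<le> h x" for x y
  proof -
    obtain a b where ab: "x = g a" "y = g b" "a < n" "b < n" "(a, b) \<in> parcs (S_tree n k r)"
      by (rule arcE[OF \<open>(x, y) \<in> parcs G\<close>])
    then have "b \<le> a" using that(2) h by simp
    then have "b = parent a" using ab(5) S_parent_less[of b k r] by (auto simp: S_tree_parcs_iff)
    then show ?thesis using ab h by simp
  qed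
  then show "y = z" if "(x, y) \<in> parcs G" "(x, z) \<in> parcs G" "h y \<le> h x" "h z \<le> h x" for x y z
    using that by metis
qed

lemma is_tree: "is_tree G"
  unfolding is_tree_def using pair_graph connected_iff rtrancl_verts cycle_iff_polygon no_polygon n
  by (auto simp: verts lessThan_empty_iff)

section \<open>Degrees and pendent paths of the copy\<close>

lemma neighbours:
  assumes "a < n"
  shows "parcs G `` {g a} = g ` (parcs (S_tree n k r) `` {a})"
proof
  show "parcs G `` {g a} \<subseteq> g ` (parcs (S_tree n k r) `` {a})"
    using assms by (auto elim!: arcE simp: g_eq_iff)
  show "g ` (parcs (S_tree n k r) `` {a}) \<subseteq> parcs G `` {g a}"
    by (force simp: S_image_def)
qed

lemma degree_g:
  assumes "a < n"
  shows "degree G (g a) = card (parcs (S_tree n k r) `` {a})"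
proof -
  have "inj_on g (parcs (S_tree n k r) `` {a})"
    using inj by (rule inj_on_subset) (auto dest: S_tree_parcs_less)
  then show ?thesis using degree_eq_card neighbours[OF assms] card_image by metis
qed

text \<open>The multiples of \<open>r\<close> up to k r are the outer ends of the long paths:
  \<open>Suc a\<close> then hangs at the centre and not at \<open>a\<close>.\<close>

lemma degree_end:
  assumes "1 \<le> a" "a < n" "a > k * r \<or> r dvd a"
  shows "degree G (g a) = 1"
proof -
  have "parcs (S_tree n k r) `` {a} = {parent a}"
    using assms by (auto simp: S_tree_parcs_iff S_parent_def split: if_splits)
  then show ?thesis using degree_g assms by simp
qed

lemma degree_inner:
  assumes "1 \<le> a" "a < k * r" "\<not> r dvd a"
  shows "degree G (g a) = 2"
proof -
  have "parcs (S_tree n k r) `` {a} = {parent a, Suc a}"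
    using assms n by (auto simp: S_tree_parcs_iff S_parent_def split: if_splits)
  moreover have "parent a \<noteq> Suc a" using S_parent_less[of a k r] assms by simp
  ultimately show ?thesis using degree_g assms n by simp
qed

text \<open>Degree 3 prevents a path of length at least 2 from starting at one of the single leaves,
  since it would need degree 2 at the centre.\<close>

lemma degree_centre: "3 \<le> degree G (g 0)"
proof -
  have "r \<le> k * r" using k by simp
  have "parent 1 = 0" by (simp add: S_parent_def)
  moreover have "parent (Suc r) = 0" by (simp add: S_parent_def)
  moreover have "k * r < n - 1" using n(1) by simp
  then have "parent (n - 1) = 0" by (simp add: S_parent_def)
  moreover have "Suc r < n" using n(1) \<open>r \<le> k * r\<close> by linarith
  \<comment> \<open>Vertex 1 starts the first long path, \<open>Suc r\<close> starts the second one
    or is a leaf when k = 1, and n - 1 is always a leaf.\<close>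
  ultimately have "{1, Suc r, n - 1} \<subseteq> parcs (S_tree n k r) `` {0}"
    by (auto simp: S_tree_parcs_iff)
  moreover have "finite (parcs (S_tree n k r) `` {0})"
    by (rule finite_subset[of _ "{..<n}"]) (auto dest: S_tree_parcs_less)
  ultimately have "card {1, Suc r, n - 1} \<le> card (parcs (S_tree n k r) `` {0})" by (rule card_mono[rotated])
  moreover have "Suc r \<noteq> n - 1"
  proof (cases "k = 1")
    case False
    then have "2 * r \<le> k * r" using k by (intro mult_right_mono) auto
    then show ?thesis using n(1) r by linarith
  qed (use n in simp)
  moreover have "1 \<noteq> n - 1" using n(1) \<open>r \<le> k * r\<close> r by linarith
  ultimately have "card {1, Suc r, n - 1} \<le> card (parcs (S_tree n k r) `` {0})"
    "card {1, Suc r, n - 1} = 3" using r by auto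
  then show ?thesis using degree_g n by simp
qed

text \<open>Numbers grow outwards while pendent paths are listed from the leaf inwards, hence r - m.
  At m = r the formula would give i r, the outer end of the previous path if i > 0, so the centre 0
  is set separately.\<close>

definition pos :: "nat \<Rightarrow> nat \<Rightarrow> nat" where
  "pos i m = (if m < r then i * r + (r - m) else 0)"

definition spoke :: "nat \<Rightarrow> 'a list" where
  "spoke i = map (\<lambda>m. g (pos i m)) [0..<Suc r]"

lemma spoke_nth: "m \<le> r \<Longrightarrow> spoke i ! m = g (pos i m)"
  unfolding spoke_def by (subst nth_map) (auto simp: nth_upt simp del: upt_Suc)

lemma pos_le: "i < k \<Longrightarrow> pos i m \<le> k * r"
proof -
  assume "i < k"
  then have "Suc i * r \<le> k * r" by (intro mult_right_mono) auto
  then show ?thesis by (auto simp: pos_def)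
qed

lemma pos_less: "i < k \<Longrightarrow> pos i m < n"
  using pos_le[of i m] n by simp

text \<open>The number \<open>pos i m\<close> minus 1 is divisible by \<open>r\<close> only for m =
  r - 1, which is where the path meets the centre.\<close>

lemma parent_pos:
  assumes "i < k" "m < r"
  shows "parent (pos i m) = pos i (Suc m)"
proof -
  have "pos i m - 1 = i * r + (r - 1 - m)" using assms by (simp add: pos_def)
  moreover have "r dvd i * r + (r - 1 - m) \<longleftrightarrow> r dvd r - 1 - m" by (simp add: dvd_add_right_iff)
  moreover have "r dvd r - 1 - m \<longleftrightarrow> m = r - 1"
    using assms r by (auto dest: dvd_imp_le)
  ultimately show ?thesis using assms pos_le[of i m] by (auto simp: S_parent_def pos_def)
qed

lemma pendent_spoke:
  assumes "i < k"
  shows "pendent_path G r (spoke i)"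
  unfolding pendent_path_iff
proof (intro conjI allI impI)
  show "1 \<le> r" using r by simp
  show "length (spoke i) = Suc r" by (simp add: spoke_def)
  have "inj_on (pos i) {0..<Suc r}" by (rule inj_onI) (auto simp: pos_def split: if_splits)
  then have "inj_on (\<lambda>m. g (pos i m)) {0..<Suc r}"
    using pos_less[OF assms] by (auto simp: inj_on_def g_eq_iff)
  then show "distinct (spoke i)" by (simp add: spoke_def distinct_map del: upt_Suc)
  show "set (spoke i) \<subseteq> pverts G" using pos_less[OF assms] by (auto simp: spoke_def verts simp del: upt_Suc)
  show "(spoke i ! m, spoke i ! Suc m) \<in> parcs G" if "m < r" for m
  proof -
    have "1 \<le> pos i m" using that by (simp add: pos_def)
    then have "(g (pos i m), g (pos i (Suc m))) \<in> parcs G"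
      using parent_arc pos_less[OF assms] parent_pos[OF assms that] by metis
    then show ?thesis using that by (simp add: spoke_nth)
  qed
  show "degree G (spoke i ! 0) = 1"
    using degree_end[of "pos i 0"] pos_less[OF assms, of 0] r by (simp add: spoke_nth pos_def)
  show "2 \<le> degree G (spoke i ! r)" using degree_centre by (simp add: spoke_nth pos_def)
  fix m assume m: "1 \<le> m \<and> m \<le> r - 1"
  have "\<not> r dvd r - m" using m by (auto dest: dvd_imp_le)
  then have "\<not> r dvd i * r + (r - m)" using dvd_add_right_iff[OF dvd_triv_right] by blast
  moreover have "m < r" using m r by linarith
  then have "pos i m = i * r + (r - m)" by (simp add: pos_def)
  ultimately have not_dvd: "\<not> r dvd pos i m" by metis
  then have "pos i m \<noteq> k * r" "pos i m \<noteq> 0" by (metis dvd_triv_right dvd_0_right)+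
  then have "degree G (g (pos i m)) = 2"
    using degree_inner[OF _ _ not_dvd] pos_le[OF assms, of m] by simp
  moreover have "m \<le> r" using m by linarith
  ultimately show "degree G (spoke i ! m) = 2" by (simp add: spoke_nth)
qed

text \<open>A start beyond k r would put the centre at index 1, where degree 2 is required.
  Otherwise the degree 1 of the start makes its number a multiple of \<open>r\<close>, hence the
  leaf of a spoke, and the leaf determines the path.\<close>

lemma pendent_path_is_spoke:
  assumes p: "pendent_path G r p"
  shows "p \<in> spoke ` {..<k}"
proof -
  obtain a where a: "p ! 0 = g a" "a < n"
    using pendent_path_nth_in_verts[OF p, of 0] by (auto simp: verts)
  have deg: "degree G (g a) = 1" using p a by (simp add: pendent_path_iff)
  then have "a \<noteq> 0" using degree_centre by (cases "a = 0") auto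
  have "a \<le> k * r"
  proof (rule ccontr)
    assume "\<not> a \<le> k * r"
    then have "parent a = 0" by (simp add: S_parent_def)
    then have "p ! 1 = g 0"
      using pendent_path_neighbours[OF p, of 0 "g 0"] parent_arc[of a] a r \<open>a \<noteq> 0\<close> by simp
    moreover have "degree G (p ! 1) = 2" using p r by (simp add: pendent_path_iff)
    ultimately show False using degree_centre by simp
  qed
  moreover have "r dvd a"
    using degree_inner[of a] deg \<open>a \<noteq> 0\<close> \<open>a \<le> k * r\<close> by (cases "a = k * r") auto
  then obtain b where b: "a = r * b" by blast
  ultimately have "b \<noteq> 0" "b \<le> k" using \<open>a \<noteq> 0\<close> r by (auto simp: mult.commute)
  then obtain i where i: "b = Suc i" "i < k" by (cases b) auto
  then have "p ! 0 = spoke i ! 0" using a b r by (simp add: spoke_nth pos_def algebra_simps)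
  then show ?thesis using pendent_path_eqI[OF p pendent_spoke] i by blast
qed

lemma card_pendent_paths: "card {p. pendent_path G r p} = k"
proof -
  have "{p. pendent_path G r p} = spoke ` {..<k}"
    using pendent_spoke pendent_path_is_spoke by blast
  moreover have "inj_on spoke {..<k}"
  proof (rule inj_onI)
    fix i j assume "i \<in> {..<k}" "j \<in> {..<k}" "spoke i = spoke j"
    then have "g (pos i 0) = g (pos j 0)" using spoke_nth[of 0] by (metis le0)
    then have "pos i 0 = pos j 0" using \<open>i \<in> _\<close> \<open>j \<in> _\<close> g_eq_iff pos_less by simp
    then show "i = j" using r by (simp add: pos_def)
  qed
  ultimately show ?thesis by (simp add: card_image)
qed

lemma S_image_in_trees: "G \<in> trees_with_pendent_paths n k r"
  using is_tree order card_pendent_paths by (simp add: trees_with_pendent_paths_def)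

end

sublocale S_copy \<subseteq> separated_pendent_paths "S_image g n k r" r
proof
  fix p q assume pq: "pendent_path G r p" "pendent_path G r q" "p \<noteq> q"
  have "finite {p. pendent_path G r p}"
    using card_pendent_paths k by (intro card_ge_0_finite) simp
  then have "card {p, q} \<le> card {p. pendent_path G r p}" using pq by (intro card_mono) auto
  then have "card {p, q} \<le> k" by (simp only: card_pendent_paths)
  then have "2 * r \<le> k * r" using pq(3) by (intro mult_right_mono) auto
  then show "2 * r < order G" using n(1) order by linarith
qed

context S_copy
begin

section \<open>The Mostar index of the copy\<close>

lemma edges_S_image: "edges G = (\<lambda>j. {g j, g (parent j)}) ` {1..<n}"
proof
  show "edges G \<subseteq> (\<lambda>j. {g j, g (parent j)}) ` {1..<n}"
  proof
    fix e assume "e \<in> edges G"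
    then obtain x y where xy: "e = {x, y}" "(x, y) \<in> parcs G" by (rule edgesE)
    from xy(2) obtain a b where "x = g a" "y = g b" "(a, b) \<in> parcs (S_tree n k r)"
      by (blast elim: arcE)
    then show "e \<in> (\<lambda>j. {g j, g (parent j)}) ` {1..<n}"
      using xy(1) by (auto simp: S_tree_parcs_iff)
  qed
  show "(\<lambda>j. {g j, g (parent j)}) ` {1..<n} \<subseteq> edges G"
    using parent_arc by (auto intro: edgesI)
qed

lemma card_edges_S_image: "card (edges G) = n - 1"
proof -
  have "inj_on (\<lambda>j. {g j, g (parent j)}) {1..<n}"
  proof (rule inj_onI)
    fix i j assume ij: "i \<in> {1..<n}" "j \<in> {1..<n}" "{g i, g (parent i)} = {g j, g (parent j)}"
    then show "i = j"
      using S_parent_less[of i k r] S_parent_less[of j k r] by (auto simp: doubleton_eq_iff g_eq_iff)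
  qed
  then show ?thesis unfolding edges_S_image by (simp add: card_image)
qed

lemma imbalance_other_edge:
  assumes "e \<in> edges G - path_edges"
  shows "edge_imbalance G e = int n - 2"
proof -
  obtain j where j: "1 \<le> j" "j < n" "e = {g j, g (parent j)}"
    using assms by (auto simp: edges_S_image)
  have "j > k * r"
  proof (rule ccontr)
    assume "\<not> j > k * r"
    \<comment> \<open>These invert \<open>pos\<close>: the block containing \<open>j\<close> and its
      position counted from the leaf.\<close>
    define i m where "i = (j - 1) div r" and "m = r - 1 - (j - 1) mod r"
    have "j - 1 < k * r" using j \<open>\<not> j > k * r\<close> by simp
    then have i: "i < k" by (simp add: i_def less_mult_imp_div_less)
    have "(j - 1) mod r < r" using r by simp
    then have m: "m < r" "r - m = Suc ((j - 1) mod r)" using r unfolding m_def by linarith+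
    have "pos i m = j" using m j div_mult_mod_eq[of "j - 1" r] by (simp add: pos_def i_def)
    then have "e = {spoke i ! m, spoke i ! Suc m}"
      using j(3) parent_pos[OF i m(1)] m by (simp add: spoke_nth)
    then have "e \<in> path_edges" using pendent_spoke[OF i] m unfolding path_edges_def by force
    then show False using assms by blast
  qed
  then have "degree G (g j) = 1" using degree_end j by blast
  then show ?thesis using imbalance_leaf parent_arc j order n by simp
qed

lemma mostar_S_image:
  "mostar G = int k * (\<Sum>i<r. \<bar>int n - 2 * (int i + 1)\<bar>) + int (n - 1 - k * r) * (int n - 2)"
proof -
  have "card (edges G - path_edges) = n - 1 - k * r"
    using card_Diff_subset[OF finite_subset[OF path_edges_subset finite_edges] path_edges_subset]
    by (simp add: card_edges_S_image card_path_edges card_pendent_paths)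
  then show ?thesis
    by (simp add: mostar_eq card_pendent_paths imbalance_other_edge order)
qed

end

section \<open>Trees all of whose other edges are pendent\<close>

context separated_pendent_paths
begin

text \<open>There are at most n - 1 - k r remaining edges, each contributing at most n - 2, so a
  single deficient edge would push the sum strictly below its assumed lower bound.\<close>

lemma other_edge_imbalance_eq:
  assumes "card (edges G) < order G" "2 < order G"
    and sum: "int (order G - 1 - card paths * r) * (int (order G) - 2)
      \<le> (\<Sum>e\<in>edges G - path_edges. edge_imbalance G e)"
    and e: "e \<in> edges G - path_edges"
  shows "edge_imbalance G e = int (order G) - 2"
proof (rule ccontr)
  let ?R = "edges G - path_edges"
  have le: "edge_imbalance G e' \<le> int (order G) - 2" if "e' \<in> ?R" for e'
    using that imbalance_le by (auto elim!: edgesE)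
  assume "edge_imbalance G e \<noteq> int (order G) - 2"
  then have "edge_imbalance G e < int (order G) - 2" using le[OF e] by simp
  then have "(\<Sum>e\<in>?R. edge_imbalance G e) < (\<Sum>e\<in>?R. int (order G) - 2)"
    using le e finite_edges by (intro sum_strict_mono_ex1) auto
  also have "\<dots> = int (card ?R) * (int (order G) - 2)" by simp
  also have "\<dots> \<le> int (order G - 1 - card paths * r) * (int (order G) - 2)"
  proof (rule mult_right_mono)
    have "card ?R = card (edges G) - card paths * r"
      using card_Diff_subset[OF finite_subset[OF path_edges_subset finite_edges] path_edges_subset]
      by (simp add: card_path_edges)
    then show "int (card ?R) \<le> int (order G - 1 - card paths * r)" using assms(1) by simp
  qed (use assms(2) in simp)
  finally show False using sum by simp
qed

text \<open>Take the end \<open>c\<close> of one path together with the bodies of all paths ending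
  at \<open>c\<close> and the leaves at \<open>c\<close> outside the bodies. No arc leaves this set
  \<open>X\<close>, so it is the whole tree.\<close>

lemma centre_structure:
  assumes p: "p \<in> paths"
    and leaf: "\<And>a b. (a, b) \<in> parcs G \<Longrightarrow> a \<notin> bodies \<Longrightarrow> b \<notin> bodies \<Longrightarrow>
      degree G a = 1 \<or> degree G b = 1"
  shows "q \<in> paths \<Longrightarrow> q ! r = p ! r"
    and "w \<in> pverts G \<Longrightarrow> w \<notin> bodies \<Longrightarrow> w \<noteq> p ! r \<Longrightarrow> (w, p ! r) \<in> parcs G"
proof -
  define c where "c = p ! r"
  define X where "X = (\<Union>q\<in>{q \<in> paths. q ! r = c}. body r q) \<union> {c} \<union>
    {w \<in> pverts G - bodies. (w, c) \<in> parcs G \<and> degree G w = 1}"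
  have deg: "2 \<le> degree G c" using p by (simp add: pendent_path_iff c_def)
  have c: "c \<in> pverts G" "c \<notin> bodies"
    using p pendent_path_nth_in_verts end_notin_bodies by (auto simp: c_def)
  have closed: "b \<in> X" if ab: "(a, b) \<in> parcs G" and a: "a \<in> X" for a b
  proof -
    consider q where "q \<in> paths" "q ! r = c" "a \<in> body r q" | "a = c"
      | "(a, c) \<in> parcs G" "degree G a = 1"
      using a by (auto simp: X_def)
    then show ?thesis
    proof cases
      case (1 q)
      then have "b \<in> body r q \<or> b = c" using pendent_path_body_cut[of r q a b] ab by blast
      then show ?thesis using 1 by (auto simp: X_def)
    next
      case 2
      show ?thesis
      proof (cases "b \<in> bodies")
        case True
        then obtain q where q: "q \<in> paths" "b \<in> body r q" by (auto simp: bodies_def)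
        then have "c \<notin> body r q" using c(2) by (auto simp: bodies_def)
        \<comment> \<open>The arc from \<open>b\<close> to \<open>c\<close> leaves the body of
          \<open>q\<close>, as \<open>c\<close> lies in no body, so it is the boundary arc.\<close>
        then have "c = q ! r"
          using pendent_path_body_cut[of r q b a] q ab 2 arcs_symmetric by blast
        then show ?thesis using q by (auto simp: X_def)
      next
        case False
        then have "degree G b = 1" using leaf[OF ab] 2 c deg by fastforce
        moreover have "(b, c) \<in> parcs G" "b \<in> pverts G" using ab 2 arcs_symmetric in_arcsD2 by blast+
        ultimately show ?thesis using False by (simp add: X_def)
      qed
    next
      case 3
      then have "b = c" using degree_1_neighbours ab by blast
      then show ?thesis by (simp add: X_def)
    qed
  qed
  have X: "pverts G \<subseteq> X"
    by (rule verts_subset_if_closed[of c]) (use c closed in \<open>auto simp: X_def\<close>)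
  show "q ! r = p ! r" if q: "q \<in> paths"
  proof -
    have "1 \<le> r" using q pendent_pathD(1) by blast
    then have q0: "q ! 0 \<in> body r q" by (simp add: body_def)
    then have "q ! 0 \<in> bodies" "q ! 0 \<in> X"
      using q X body_subset by (auto simp: bodies_def)
    then obtain q' where "q' \<in> paths" "q' ! r = c" "q ! 0 \<in> body r q'"
      using c by (auto simp: X_def)
    then show ?thesis using paths_eq_if_common[OF q _ q0] c_def by blast
  qed
  show "(w, p ! r) \<in> parcs G" if "w \<in> pverts G" "w \<notin> bodies" "w \<noteq> p ! r"
    using that X by (auto simp: X_def bodies_def c_def)
qed

text \<open>The structure around the centre dictates a numbering \<open>g\<close> under which all
  arcs of S are arcs of \<open>G\<close>; comparing edge counts then gives equality.\<close>

lemma eq_S_image: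
  assumes "1 \<le> card paths" "2 \<le> r" "card paths * r + 2 \<le> order G"
    "card paths = 1 \<Longrightarrow> r + 3 \<le> order G" "card (edges G) < order G"
    and leaf: "\<And>a b. (a, b) \<in> parcs G \<Longrightarrow> a \<notin> bodies \<Longrightarrow> b \<notin> bodies \<Longrightarrow>
      degree G a = 1 \<or> degree G b = 1"
  obtains g where "inj_on g {..<order G}" "G = S_image g (order G) (card paths) r"
proof -
  define n where "n = order G"
  define k where "k = card paths"
  obtain h where h: "bij_betw h {0..<k} paths"
    using ex_bij_betw_nat_finite[OF finite_paths] by (auto simp: k_def)
  have hp: "h i \<in> paths" if "i < k" for i using h that by (auto simp: bij_betw_def)
  define c where "c = h 0 ! r"
  have k0: "0 < k" using assms by (simp add: k_def)
  have c: "c \<in> pverts G" "c \<notin> bodies"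
    using hp[OF k0] pendent_path_nth_in_verts end_notin_bodies by (auto simp: c_def)
  have ends: "h i ! r = c" if "i < k" for i
    using centre_structure(1)[OF hp[OF k0] leaf hp[OF that]] by (simp add: c_def)
  define L where "L = pverts G - bodies - {c}"
  have L_arc: "(w, c) \<in> parcs G" if "w \<in> L" for w
    using centre_structure(2)[OF hp[OF k0] leaf] that by (auto simp: L_def c_def)
  have "card (pverts G - bodies) = n - k * r"
    using card_Diff_subset[OF finite_subset[OF bodies_subset pair_finite_verts] bodies_subset]
    by (simp add: n_def order_def card_bodies k_def)
  then have "card L = n - k * r - 1"
    unfolding L_def using c by (simp add: card_Diff_singleton)
  then obtain l where l: "bij_betw l {0..<n - k * r - 1} L"
    using ex_bij_betw_nat_finite[of L] pair_finite_verts by (auto simp: L_def)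
  \<comment> \<open>Centre first, then the bodies in blocks of length \<open>r\<close>, then the
    leaves. Within a block the list index decreases, from r - 1 next to the centre to 0 at the
    leaf.\<close>
  define g where "g j = (if j = 0 then c else if j \<le> k * r
      then h ((j - 1) div r) ! (r - 1 - (j - 1) mod r) else l (j - k * r - 1))" for j
  have kr: "k * r < n" using assms by (simp add: k_def n_def)
  have g_path: "g (Suc (i * r + m)) = h i ! (r - 1 - m)" "Suc (i * r + m) \<le> k * r"
    if "i < k" "m < r" for i m
  proof -
    have "Suc i * r \<le> k * r" using that by (intro mult_right_mono) auto
    then show "Suc (i * r + m) \<le> k * r" using that by simp
    then show "g (Suc (i * r + m)) = h i ! (r - 1 - m)" using that by (simp add: g_def)
  qed
  have "pverts G \<subseteq> g ` {..<n}"
  proof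
    fix x assume x: "x \<in> pverts G"
    consider "x = c" | "x \<in> bodies" | "x \<in> L" using x by (auto simp: L_def)
    then show "x \<in> g ` {..<n}"
    proof cases
      case 1
      then show ?thesis using kr by (intro image_eqI[of _ _ 0]) (auto simp: g_def)
    next
      case 2
      then obtain q m where q: "q \<in> paths" "m < r" "x = q ! m" by (auto simp: bodies_def body_def)
      then obtain i where i: "i < k" "q = h i"
        using h q(1) unfolding bij_betw_def by (metis atLeastLessThan_iff imageE)
      have "r - 1 - (r - 1 - m) = m" using q by simp
      then show ?thesis
        using g_path[OF i(1), of "r - 1 - m"] q i kr
        by (intro image_eqI[of _ _ "Suc (i * r + (r - 1 - m))"]) auto
    next
      case 3
      then obtain j where "j < n - k * r - 1" "x = l j" using l by (auto simp: bij_betw_def)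
      then show ?thesis by (intro image_eqI[of _ _ "Suc (k * r + j)"]) (auto simp: g_def)
    qed
  qed
  \<comment> \<open>Covering all n vertices with n numbers yields both injectivity and the exact
    image.\<close>
  moreover have "card {..<n} = card (pverts G)" by (simp add: n_def order_def)
  moreover have "card (g ` {..<n}) \<le> card {..<n}" by (rule card_image_le) simp
  ultimately have gV: "pverts G = g ` {..<n}" and inj: "inj_on g {..<n}"
    using card_seteq[of "g ` {..<n}" "pverts G"] card_mono[of "g ` {..<n}" "pverts G"]
    by (auto intro!: eq_card_imp_inj_on)
  have arcs: "(g j, g (S_parent k r j)) \<in> parcs G" if j: "1 \<le> j" "j < n" for j
  proof (cases "j \<le> k * r")
    case True
    define i m where "i = (j - 1) div r" and "m = (j - 1) mod r"
    have "j - 1 < k * r" using True j by simp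
    then have i: "i < k" by (simp add: i_def less_mult_imp_div_less)
    have m: "m < r" using assms(2) by (simp add: m_def)
    have j_eq: "j = Suc (i * r + m)" using j by (simp add: i_def m_def)
    have path: "pendent_path G r (h i)" using hp[OF i] by simp
    have "g (S_parent k r j) = h i ! Suc (r - 1 - m)"
    proof (cases "m = 0")
      case True
      then have "S_parent k r j = 0" by (simp add: S_parent_def j_eq)
      then show ?thesis using True m ends[OF i] by (simp add: g_def)
    next
      case False
      then have "\<not> r dvd i * r + m" using m by (auto simp: dvd_add_right_iff dest: dvd_imp_le)
      then have "S_parent k r j = Suc (i * r + (m - 1))"
        using True False by (simp add: S_parent_def j_eq)
      moreover have "r - 1 - (m - 1) = Suc (r - 1 - m)" using False m by simp
      ultimately show ?thesis using g_path(1)[OF i, of "m - 1"] m by (metis less_imp_diff_less)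
    qed
    then show ?thesis
      using g_path(1)[OF i m] pendent_pathD(5)[OF path, of "r - 1 - m"] m by (simp add: j_eq)
  next
    case False
    then have "S_parent k r j = 0" by (simp add: S_parent_def)
    moreover have "g j \<in> L" using False j l by (auto simp: g_def bij_betw_def)
    ultimately show ?thesis using L_arc by (simp add: g_def)
  qed
  let ?H = "S_image g n k r"
  have "parcs ?H \<subseteq> parcs G"
    using arcs arcs_symmetric by (auto simp: S_image_def S_tree_def)
  moreover have "parcs G \<subseteq> parcs ?H"
  proof -
    have H: "S_copy g n k r"
      using inj assms by unfold_locales (auto simp: n_def k_def)
    have "edges ?H \<subseteq> edges G" using \<open>parcs ?H \<subseteq> parcs G\<close> by (auto simp: edges_def)
    \<comment> \<open>The copy has n - 1 edges and \<open>G\<close> has fewer than n, so the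
      inclusion cannot be strict.\<close>
    then have eq: "edges ?H = edges G"
      using assms(5) S_copy.card_edges_S_image[OF H] by (intro card_seteq finite_edges) (auto simp: n_def)
    show ?thesis
    proof (rule subrelI)
      fix a b assume "(a, b) \<in> parcs G"
      then have "{a, b} \<in> edges ?H" unfolding eq by (rule edgesI)
      then show "(a, b) \<in> parcs ?H" by (simp only: connected_graph.in_edges_iff[OF S_copy.connected_graph_S_image[OF H]])
    qed
  qed
  ultimately have "G = ?H" using gV by (intro pair_pre_digraph.equality) (auto simp: S_image_def)
  then show ?thesis using that inj by (simp add: n_def k_def)
qed

text \<open>Two labellings occur: an arbitrary enumeration of the vertices builds the competitor
  that forces the other edges to be pendent, and only then does \<open>eq_S_image\<close> give the
  labelling that identifies \<open>G\<close>.\<close>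

lemma eq_S_image_if_maximal:
  assumes params: "1 \<le> card paths" "2 \<le> r" "card paths * r + 2 \<le> order G"
      "card paths = 1 \<Longrightarrow> r + 3 \<le> order G"
    and few_edges: "card (edges G) < order G"
    and no_polygon: "\<nexists>vs. polygon (parcs G) vs"
    and max: "\<And>T' :: 'a pair_pre_digraph. T' \<in> trees_with_pendent_paths (order G) (card paths) r \<Longrightarrow> mostar T' \<le> mostar G"
  obtains g where "inj_on g {..<order G}" "G = S_image g (order G) (card paths) r"
proof -
  let ?n = "order G" and ?k = "card paths"
  obtain g where g: "bij_betw g {0..<?n} (pverts G)"
    using ex_bij_betw_nat_finite[OF pair_finite_verts] by (auto simp: order_def)
  have S: "S_copy g ?n ?k r"
    using g params by unfold_locales (auto simp: bij_betw_def atLeast0LessThan)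
  have "mostar (S_image g ?n ?k r) \<le> mostar G"
    using max S_copy.S_image_in_trees[OF S] by blast
  \<comment> \<open>The equal contributions of the path edges cancel.\<close>
  then have sum: "int (?n - 1 - ?k * r) * (int ?n - 2) \<le> (\<Sum>e\<in>edges G - path_edges. edge_imbalance G e)"
    unfolding S_copy.mostar_S_image[OF S] mostar_eq by simp
  have "1 * 2 \<le> ?k * r" using params by (intro mult_le_mono)
  then have "2 < ?n" using params(3) by simp
  then have other: "edge_imbalance G e = int ?n - 2" if "e \<in> edges G - path_edges" for e
    using other_edge_imbalance_eq[OF few_edges _ sum that] by blast
  have "degree G a = 1 \<or> degree G b = 1"
    if "(a, b) \<in> parcs G" "a \<notin> bodies" "b \<notin> bodies" for a b
    using leaf_if_imbalance[OF that(1) _ no_polygon] other[of "{a, b}"] that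
      path_edges_disjoint edgesI by auto
  then show ?thesis using eq_S_image[OF params few_edges] that by blast
qed

end

section \<open>Application to trees\<close>

lemma (in pair_graph) no_polygon_if_tree: "is_tree G \<Longrightarrow> \<nexists>vs. polygon (parcs G) vs"
  using cycle_iff_polygon by (auto simp: is_tree_def)

lemma (in pair_graph) card_edges_if_tree:
  assumes "is_tree G"
  shows "card (edges G) < order G"
  unfolding edges_def order_def
proof (rule card_edges_le_if_no_polygon)
  show "parcs G \<subseteq> pverts G \<times> pverts G" using in_arcsD1 in_arcsD2 by auto
  show "sym (parcs G)" using arcs_symmetric by (rule symI)
  show "irrefl (parcs G)" using pair_no_loops by (fastforce simp: irrefl_def)
qed (use assms pair_finite_verts connected_iff no_polygon_if_tree in \<open>auto simp: is_tree_def\<close>)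

theorem theorem5p1:
  fixes n k r :: nat and T :: "'a pair_pre_digraph"
  assumes "(k = 1 \<and> 2 \<le> r \<and> r + 3 \<le> n) \<or> (2 \<le> k \<and> 2 \<le> r \<and> k * r + 2 \<le> n)"
    and "T \<in> trees_with_pendent_paths n k r"
    and "\<forall>T' \<in> (trees_with_pendent_paths n k r :: 'a pair_pre_digraph set). mostar T' \<le> mostar T"
  shows "digraph_iso (with_proj T) (with_proj (S_tree n k r))"
proof -
  have params: "1 \<le> k" "2 \<le> r" "k * r + 2 \<le> n" "k = 1 \<Longrightarrow> r + 3 \<le> n"
    using assms(1) by auto
  have tree: "is_tree T" and order: "order T = n" and card: "card {p. pendent_path T r p} = k"
    using assms(2) by (auto simp: trees_with_pendent_paths_def)
  have T: "pair_graph T" using tree by (simp add: is_tree_def)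
  have "connected_graph T"
    using T tree pair_graph.connected_iff[OF T]
    by (auto simp: is_tree_def intro!: connected_graph.intro connected_graph_axioms.intro)
  moreover have "2 * r < order T"
    if pq: "pendent_path T r p" "pendent_path T r q" "p \<noteq> q" for p q
  proof -
    \<comment> \<open>An infinite set has \<open>card\<close> 0, so k \<ge> 1 already yields
      finiteness.\<close>
    have "finite {p. pendent_path T r p}"
      using card params(1) by (intro card_ge_0_finite) simp
    then have "card {p, q} \<le> k" unfolding card[symmetric] using pq by (intro card_mono) auto
    then have "2 * r \<le> k * r" using pq(3) by (intro mult_right_mono) auto
    then show ?thesis using params(3) order by linarith
  qed
  ultimately have "separated_pendent_paths T r"
    by (intro separated_pendent_paths.intro separated_pendent_paths_axioms.intro)
  then obtain g where "inj_on g {..<n}" "T = S_image g n k r"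
    using separated_pendent_paths.eq_S_image_if_maximal[of T r] params assms(3)
      pair_graph.card_edges_if_tree[OF T tree] pair_graph.no_polygon_if_tree[OF T tree]
    unfolding card order by metis
  then show ?thesis using digraph_iso_S_image by metis
qed

end
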